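(* Let $U,V\subset\mathbb{C}^n$ be two open subsets, and let $L_U$, $L_V$ be holomorphic line bundles defined over $U$ and $V$ respectively. If $L_U|_{U\cap V}\cong L_V|_{U\cap V}$ are isomorphic as holomorphic line bundles, then there exists a holomorphic line bundle $L$ defined over $U\cup V$ such that $L|_U\cong L_U$ and $L|_V\cong L_V$ as holomorphic line bundles. *)

theory Defs
  imports "HOL-Analysis.Analysis" "HOL-Algebra.Module"
begin

section \<open>Complex normed vector spaces\<close>

text \<open>The model spaces below are $\mathbb{C}^n$, i.e. \<^typ>\<open>complex^'n\<close>, and
  $\mathbb{C}^n \times \mathbb{C}$, the model space of the total space of a line bundle.
  The class makes complex scalar multiplication available on both.\<close>

class complex_normed_vector = real_normed_vector +
  fixes scaleC :: "complex \<Rightarrow> 'a \<Rightarrow> 'a"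
  assumes scaleC_add_right: "scaleC c (x + y) = scaleC c x + scaleC c y"
    and scaleC_add_left: "scaleC (c + d) x = scaleC c x + scaleC d x"
    and scaleC_scaleC: "scaleC c (scaleC d x) = scaleC (c * d) x"
    and scaleC_one: "scaleC 1 x = x"
    and scaleC_of_real: "scaleC (complex_of_real r) x = r *\<^sub>R x"
    and norm_scaleC: "norm (scaleC c x) = cmod c * norm x"

instantiation complex :: complex_normed_vector
begin

definition scaleC_complex :: "complex \<Rightarrow> complex \<Rightarrow> complex"
  where "scaleC_complex c x = c * x"

instance
  by standard (simp_all add: scaleC_complex_def algebra_simps norm_mult scaleR_conv_of_real)

end

instantiation prod :: (complex_normed_vector, complex_normed_vector) complex_normed_vector
begin

definition scaleC_prod :: "complex \<Rightarrow> 'a \<times> 'b \<Rightarrow> 'a \<times> 'b"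
  where "scaleC_prod c x = (scaleC c (fst x), scaleC c (snd x))"

instance
proof
  fix c :: complex and x :: "'a \<times> 'b"
  have "sqrt ((cmod c * norm (fst x))\<^sup>2 + (cmod c * norm (snd x))\<^sup>2)
      = sqrt ((cmod c)\<^sup>2 * ((norm (fst x))\<^sup>2 + (norm (snd x))\<^sup>2))"
    by (simp add: power_mult_distrib algebra_simps)
  then show "norm (scaleC c x) = cmod c * norm x"
    by (simp add: scaleC_prod_def norm_prod_def norm_scaleC real_sqrt_mult)
qed (simp_all add: scaleC_prod_def scaleC_add_right scaleC_add_left scaleC_scaleC scaleC_one
      scaleC_of_real scaleR_prod_def)

end

instantiation vec :: (complex_normed_vector, finite) complex_normed_vector
begin

definition scaleC_vec :: "complex \<Rightarrow> 'a ^ 'b \<Rightarrow> 'a ^ 'b"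
  where "scaleC_vec c x = (\<chi> i. scaleC c (x $ i))"

instance
  by standard
    (simp_all add: scaleC_vec_def vec_eq_iff scaleC_add_right scaleC_add_left scaleC_scaleC
      scaleC_one scaleC_of_real norm_vec_def norm_scaleC L2_set_right_distrib)

end

lemma scaleC_vec_eq: "scaleC c (x :: complex ^ 'n) = c *s x"
  by (simp add: scaleC_vec_def scaleC_complex_def vec_eq_iff)

text \<open>Holomorphy in several variables, on an open set: complex Fr\'echet differentiability at
  every point.\<close>

definition holomorphic_fun ::
    "('a::complex_normed_vector \<Rightarrow> 'b::complex_normed_vector) \<Rightarrow> 'a set \<Rightarrow> bool"
  where "holomorphic_fun f S \<longleftrightarrow>
    (\<forall>x\<in>S. \<exists>D. (f has_derivative D) (at x) \<and> (\<forall>c h. D (scaleC c h) = scaleC c (D h)))"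


section \<open>Complex manifolds\<close>

text \<open>A chart is a pair of a domain and a map, whose values outside the domain are irrelevant.
  A manifold carries one atlas, not necessarily a maximal one; notions below only depend on the
  complex structure generated by it.\<close>

record ('a, 'm) manifold_data =
  points :: "'a topology"
  atlas :: "('a set \<times> ('a \<Rightarrow> 'm)) set"

definition is_chart :: "'a topology \<Rightarrow> 'a set \<Rightarrow> ('a \<Rightarrow> 'm::complex_normed_vector) \<Rightarrow> bool"
  where "is_chart X D \<phi> \<longleftrightarrow> openin X D \<and> open (\<phi> ` D) \<and>
    homeomorphic_map (subtopology X D) (top_of_set (\<phi> ` D)) \<phi>"

definition complex_manifold :: "('a, 'm::complex_normed_vector) manifold_data \<Rightarrow> bool"
  where "complex_manifold M \<longleftrightarrow>
    Hausdorff_space (points M) \<and> second_countable (points M) \<and>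
    (\<forall>(D, \<phi>) \<in> atlas M. is_chart (points M) D \<phi>) \<and>
    (\<Union>(D, \<phi>) \<in> atlas M. D) = topspace (points M) \<and>
    (\<forall>(D, \<phi>) \<in> atlas M. \<forall>(D', \<phi>') \<in> atlas M.
      holomorphic_fun (\<phi>' \<circ> inv_into D \<phi>) (\<phi> ` (D \<inter> D')))"

definition holomorphic_map ::
    "('a, 'm::complex_normed_vector) manifold_data \<Rightarrow>
     ('b, 'k::complex_normed_vector) manifold_data \<Rightarrow> ('a \<Rightarrow> 'b) \<Rightarrow> bool"
  where "holomorphic_map M N f \<longleftrightarrow>
    continuous_map (points M) (points N) f \<and>
    (\<forall>(D, \<phi>) \<in> atlas M. \<forall>(D', \<phi>') \<in> atlas N.
      holomorphic_fun (\<phi>' \<circ> f \<circ> inv_into D \<phi>) (\<phi> ` (D \<inter> f -` D')))"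

definition biholomorphic_map ::
    "('a, 'm::complex_normed_vector) manifold_data \<Rightarrow>
     ('b, 'k::complex_normed_vector) manifold_data \<Rightarrow> ('a \<Rightarrow> 'b) \<Rightarrow> bool"
  where "biholomorphic_map M N f \<longleftrightarrow> holomorphic_map M N f \<and>
    (\<exists>g. holomorphic_map N M g \<and>
      (\<forall>x \<in> topspace (points M). g (f x) = x) \<and> (\<forall>y \<in> topspace (points N). f (g y) = y))"

text \<open>Open subsets of the model space, and open subsets of a manifold, as manifolds:\<close>

definition open_manifold :: "'m::complex_normed_vector set \<Rightarrow> ('m, 'm) manifold_data"
  where "open_manifold W = \<lparr>points = top_of_set W, atlas = {(W, \<lambda>x. x)}\<rparr>"

definition restrict_manifold :: "('a, 'm) manifold_data \<Rightarrow> 'a set \<Rightarrow> ('a, 'm) manifold_data"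
  where "restrict_manifold M S =
    \<lparr>points = subtopology (points M) S, atlas = (\<lambda>(D, \<phi>). (D \<inter> S, \<phi>)) ` atlas M\<rparr>"


section \<open>Holomorphic line bundles\<close>

text \<open>Complex vector spaces with a carrier set are HOL-Algebra modules over
  \<open>complex_field\<close>. The fields \<^const>\<open>mult\<close> and \<^const>\<open>one\<close>, which the record of a module
  inherits from rings, play no role.\<close>

definition complex_field :: "complex ring"
  where "complex_field = \<lparr>carrier = UNIV, mult = (*), one = 1, zero = 0, add = (+)\<rparr>"

definition complex_line :: "(complex, complex) module"
  where "complex_line =
    \<lparr>carrier = UNIV, mult = (*), one = 1, zero = 0, add = (+), smult = (*)\<rparr>"

definition complex_linear :: "(complex, 'a) module \<Rightarrow> (complex, 'b) module \<Rightarrow> ('a \<Rightarrow> 'b) \<Rightarrow> bool"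
  where "complex_linear F G f \<longleftrightarrow> f \<in> carrier F \<rightarrow> carrier G \<and>
    (\<forall>v \<in> carrier F. \<forall>w \<in> carrier F. f (v \<oplus>\<^bsub>F\<^esub> w) = f v \<oplus>\<^bsub>G\<^esub> f w) \<and>
    (\<forall>c. \<forall>v \<in> carrier F. f (c \<odot>\<^bsub>F\<^esub> v) = c \<odot>\<^bsub>G\<^esub> f v)"

record ('e, 'b) bundle_data =
  total_space :: "('e, 'b \<times> complex) manifold_data"
  bproj :: "'e \<Rightarrow> 'b"
  fibre :: "'b \<Rightarrow> (complex, 'e) module"

definition part_over :: "('e, 'b) bundle_data \<Rightarrow> 'b set \<Rightarrow> 'e set"
  where "part_over L W = {e \<in> topspace (points (total_space L)). bproj L e \<in> W}"

text \<open>That the fibres have dimension one is part of the fibrewise linear bijection with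
  $\mathbb{C}$.\<close>

definition local_trivialization ::
    "('e, 'b::complex_normed_vector) bundle_data \<Rightarrow> 'b set \<Rightarrow> ('e \<Rightarrow> 'b \<times> complex) \<Rightarrow> bool"
  where "local_trivialization L W h \<longleftrightarrow>
    biholomorphic_map (restrict_manifold (total_space L) (part_over L W))
      (open_manifold (W \<times> UNIV)) h \<and>
    (\<forall>e \<in> part_over L W. fst (h e) = bproj L e) \<and>
    (\<forall>x\<in>W. complex_linear (fibre L x) complex_line (snd \<circ> h))"

definition holomorphic_line_bundle ::
    "'b::complex_normed_vector set \<Rightarrow> ('e, 'b) bundle_data \<Rightarrow> bool"
  where "holomorphic_line_bundle U L \<longleftrightarrow>
    complex_manifold (total_space L) \<and>
    holomorphic_map (total_space L) (open_manifold U) (bproj L) \<and>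
    (\<forall>x\<in>U. module complex_field (fibre L x) \<and> carrier (fibre L x) = part_over L {x}) \<and>
    (\<forall>x\<in>U. \<exists>W h. open W \<and> x \<in> W \<and> W \<subseteq> U \<and> local_trivialization L W h)"

definition restrict_line_bundle ::
    "('e, 'b) bundle_data \<Rightarrow> 'b set \<Rightarrow> ('e, 'b) bundle_data"
  where "restrict_line_bundle L W =
    \<lparr>total_space = restrict_manifold (total_space L) (part_over L W),
     bproj = bproj L, fibre = fibre L\<rparr>"

text \<open>Isomorphism of holomorphic line bundles over the same open set \<open>U\<close>, covering the identity
  of \<open>U\<close>.\<close>

definition line_bundle_isomorphic ::
    "'b::complex_normed_vector set \<Rightarrow> ('e, 'b) bundle_data \<Rightarrow> ('f, 'b) bundle_data \<Rightarrow> bool"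
  where "line_bundle_isomorphic U L L' \<longleftrightarrow>
    (\<exists>f. biholomorphic_map (total_space L) (total_space L') f \<and>
      (\<forall>e \<in> topspace (points (total_space L)). bproj L' (f e) = bproj L e) \<and>
      (\<forall>x\<in>U. complex_linear (fibre L x) (fibre L' x) f))"

end

theory Submission
  imports Defs
begin

text \<open>The bundles are glued along the isomorphism over the overlap. The total space is the disjoint
  union of \<open>LU\<close> and the part of \<open>LV\<close> outside \<open>U\<close>; both total spaces embed into it, and on the
  overlap the two embeddings differ by the given isomorphism, so the two complex structures agree
  there and their union is an atlas. It is Hausdorff because points over different base points are
  separated by the projection, and points over the same base point lie in one of the two open
  pieces, each of which is Hausdorff.\<close>

section \<open>Manifolds and holomorphic maps\<close>

text \<open>Two open sets have no triple overlap, so no cocycle condition restricts the isomorphism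
  and any choice of it works. Hausdorffness is the one axiom that gluing can destroy, as the line
  with two origins shows; the projection to the base excludes this. The recurring technical obstacle
  is that a chart is a total function with a separate domain: \<open>inv_into D \<phi>\<close> is
  meaningful only on the image of \<open>D\<close>, and shrinking the domain replaces it by another
  function. Coordinate expressions are therefore compared near one point, on the image of an open
  set where both inverses are known. Local triviality and holomorphy of the projection are not
  derived from the glued atlas. Once the two complex structures match, the glued bundle restricted
  to \<open>U\<close> or \<open>V\<close> is isomorphic to \<open>LU\<close> or \<open>LV\<close>,
  and these local properties are transported along the isomorphisms that the theorem asks for
  anyway.\<close>

text \<open>The condition at a single point behind \<open>holomorphic_fun\<close>. Working pointwise
  lets each chart computation choose its own small neighbourhood.\<close>

definition cdifferentiable ::
    "('a::complex_normed_vector \<Rightarrow> 'b::complex_normed_vector) \<Rightarrow> 'a \<Rightarrow> bool"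
  where "cdifferentiable f x \<longleftrightarrow>
    (\<exists>D. (f has_derivative D) (at x) \<and> (\<forall>c h. D (scaleC c h) = scaleC c (D h)))"

lemma holomorphic_fun_iff: "holomorphic_fun f S \<longleftrightarrow> (\<forall>x\<in>S. cdifferentiable f x)"
  by (simp add: holomorphic_fun_def cdifferentiable_def)

lemma cdifferentiable_id: "cdifferentiable (\<lambda>x. x) x"
  unfolding cdifferentiable_def by (rule exI[of _ "\<lambda>h. h"]) auto

lemma cdifferentiable_comp:
  assumes "cdifferentiable f x" and "cdifferentiable g (f x)"
  shows "cdifferentiable (g \<circ> f) x"
proof -
  obtain D where D: "(f has_derivative D) (at x)" "\<And>c h. D (scaleC c h) = scaleC c (D h)"
    using assms(1) by (auto simp: cdifferentiable_def)
  obtain E where E: "(g has_derivative E) (at (f x))" "\<And>c h. E (scaleC c h) = scaleC c (E h)"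
    using assms(2) by (auto simp: cdifferentiable_def)
  have "(g \<circ> f has_derivative E \<circ> D) (at x)"
    by (rule diff_chain_at[OF D(1) E(1)])
  then show ?thesis
    using D(2) E(2) unfolding cdifferentiable_def by (intro exI[of _ "E \<circ> D"]) simp
qed

lemma cdifferentiable_cong:
  assumes "cdifferentiable f x" "open T" "x \<in> T" "\<And>y. y \<in> T \<Longrightarrow> f y = g y"
  shows "cdifferentiable g x"
  using assms has_derivative_transform_within_open[of f _ x UNIV T g]
  unfolding cdifferentiable_def by fastforce

section \<open>Charts and coordinate expressions near a point\<close>

text \<open>Since the domain and its image are both open, openness in the subspaces is openness in
  the ambient spaces. The form on the right avoids subtopologies and reduces restricting,
  transporting and uniting charts to set identities.\<close>

lemma is_chart_iff:
  "is_chart X D \<phi> \<longleftrightarrow> openin X D \<and> inj_on \<phi> D \<and>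
    (\<forall>S. openin X S \<longrightarrow> S \<subseteq> D \<longrightarrow> open (\<phi> ` S)) \<and>
    (\<forall>W. open W \<longrightarrow> openin X (D \<inter> \<phi> -` W))" (is "?L \<longleftrightarrow> ?R")
proof
  assume L: ?L
  then have D: "openin X D" and oD: "open (\<phi> ` D)"
    and h: "homeomorphic_map (subtopology X D) (top_of_set (\<phi> ` D)) \<phi>"
    by (auto simp: is_chart_def)
  have tD: "topspace (subtopology X D) = D"
    using D by (metis topspace_subtopology_subset openin_subset)
  have "inj_on \<phi> D"
    using homeomorphic_imp_injective_map[OF h] tD by simp
  moreover have "open (\<phi> ` S)" if "openin X S" "S \<subseteq> D" for S
  proof -
    have "openin (subtopology X D) S"
      using D that by (simp add: openin_open_subtopology)
    then have "openin (top_of_set (\<phi> ` D)) (\<phi> ` S)"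
      using homeomorphic_imp_open_map[OF h] by (simp add: open_map_def)
    then show ?thesis
      using oD openin_open_eq by blast
  qed
  moreover have "openin X (D \<inter> \<phi> -` W)" if "open W" for W
  proof -
    have "openin (top_of_set (\<phi> ` D)) (\<phi> ` D \<inter> W)"
      using that by blast
    then have "openin (subtopology X D)
        {x \<in> topspace (subtopology X D). \<phi> x \<in> \<phi> ` D \<inter> W}"
      using homeomorphic_imp_continuous_map[OF h] openin_continuous_map_preimage by blast
    moreover have "{x \<in> topspace (subtopology X D). \<phi> x \<in> \<phi> ` D \<inter> W} = D \<inter> \<phi> -` W"
      using tD by auto
    ultimately show ?thesis
      using D openin_trans_full by fastforce
  qed
  ultimately show ?R
    using D by blast
next
  assume R: ?R
  then have tD: "topspace (subtopology X D) = D"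
    by (metis topspace_subtopology_subset openin_subset)
  have oD: "open (\<phi> ` D)"
    using R by blast
  have "homeomorphic_map (subtopology X D) (top_of_set (\<phi> ` D)) \<phi>"
  proof (rule bijective_open_imp_homeomorphic_map)
    have "openin (subtopology X D) {x \<in> D. \<phi> x \<in> W}"
      if "openin (top_of_set (\<phi> ` D)) W" for W
    proof -
      have "open W"
        using that oD openin_open_eq by blast
      then have "openin X (D \<inter> \<phi> -` W)"
        using R by blast
      moreover have "{x \<in> D. \<phi> x \<in> W} = D \<inter> \<phi> -` W"
        by auto
      ultimately show ?thesis
        using R by (simp add: openin_open_subtopology)
    qed
    then show "continuous_map (subtopology X D) (top_of_set (\<phi> ` D)) \<phi>"
      using tD by (auto simp: continuous_map)
    show "open_map (subtopology X D) (top_of_set (\<phi> ` D)) \<phi>"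
      unfolding open_map_def
    proof (intro allI impI)
      fix S assume "openin (subtopology X D) S"
      then have "openin X S" "S \<subseteq> D"
        using R by (auto simp: openin_open_subtopology)
      then show "openin (top_of_set (\<phi> ` D)) (\<phi> ` S)"
        using R by (simp add: image_mono open_subset)
    qed
  qed (use R tD in auto)
  then show ?L
    using R oD by (simp add: is_chart_def)
qed

lemma is_chart_subtopology:
  assumes "is_chart X D \<phi>" "openin X S"
  shows "is_chart (subtopology X S) (D \<inter> S) \<phi>"
proof -
  have "openin X (D \<inter> S \<inter> \<phi> -` W)" if "open W" for W
  proof -
    have "openin X ((D \<inter> \<phi> -` W) \<inter> S)"
      using assms that by (auto simp: is_chart_iff)
    moreover have "(D \<inter> \<phi> -` W) \<inter> S = D \<inter> S \<inter> \<phi> -` W"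
      by auto
    ultimately show ?thesis
      by simp
  qed
  then show ?thesis
    using assms by (auto simp: is_chart_iff openin_open_subtopology intro: inj_on_subset)
qed

text \<open>Injectivity on \<open>D\<close> and on \<open>E\<close> makes both inverses undo
  \<open>\<phi>\<close> on the image of \<open>S\<close>, which is open because \<open>D\<close> is
  a chart domain, and a derivative only sees the germ. This serves both to replace \<open>F\<close>
  by \<open>G\<close> and to shrink or enlarge the domain of a chart.\<close>

lemma cdifferentiable_chart_cong:
  assumes "cdifferentiable (F \<circ> inv_into D \<phi>) (\<phi> x)"
    and "is_chart X D \<phi>" "inj_on \<phi> E" "openin X S" "S \<subseteq> D" "S \<subseteq> E" "x \<in> S"
    and "\<And>y. y \<in> S \<Longrightarrow> F y = G y"
  shows "cdifferentiable (G \<circ> inv_into E \<phi>) (\<phi> x)"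
proof (rule cdifferentiable_cong[OF assms(1), of "\<phi> ` S"])
  show "open (\<phi> ` S)"
    using assms by (auto simp: is_chart_iff)
  show "\<phi> x \<in> \<phi> ` S"
    using assms by auto
next
  fix z assume "z \<in> \<phi> ` S"
  then obtain y where y: "y \<in> S" "z = \<phi> y" by auto
  have "inj_on \<phi> D"
    using assms by (auto simp: is_chart_iff)
  then show "(F \<circ> inv_into D \<phi>) z = (G \<circ> inv_into E \<phi>) z"
    using y assms by (simp add: subset_iff)
qed

section \<open>Pointwise forms of the manifold and holomorphy conditions\<close>

lemma complex_manifold_iff:
  "complex_manifold M \<longleftrightarrow>
    Hausdorff_space (points M) \<and> second_countable (points M) \<and>
    (\<forall>D \<phi>. (D, \<phi>) \<in> atlas M \<longrightarrow> is_chart (points M) D \<phi>) \<and>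
    (\<forall>x \<in> topspace (points M). \<exists>D \<phi>. (D, \<phi>) \<in> atlas M \<and> x \<in> D) \<and>
    (\<forall>D \<phi> E \<psi> x. (D, \<phi>) \<in> atlas M \<longrightarrow> (E, \<psi>) \<in> atlas M \<longrightarrow> x \<in> D \<longrightarrow> x \<in> E \<longrightarrow>
      cdifferentiable (\<psi> \<circ> inv_into D \<phi>) (\<phi> x))"
proof -
  have charts: "(\<forall>(D, \<phi>) \<in> atlas M. is_chart (points M) D \<phi>) \<longleftrightarrow>
      (\<forall>D \<phi>. (D, \<phi>) \<in> atlas M \<longrightarrow> is_chart (points M) D \<phi>)"
    by auto
  have trans: "(\<forall>(D, \<phi>) \<in> atlas M. \<forall>(E, \<psi>) \<in> atlas M.
        holomorphic_fun (\<psi> \<circ> inv_into D \<phi>) (\<phi> ` (D \<inter> E))) \<longleftrightarrow>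
      (\<forall>D \<phi> E \<psi> x. (D, \<phi>) \<in> atlas M \<longrightarrow> (E, \<psi>) \<in> atlas M \<longrightarrow> x \<in> D \<longrightarrow> x \<in> E \<longrightarrow>
        cdifferentiable (\<psi> \<circ> inv_into D \<phi>) (\<phi> x))"
    unfolding holomorphic_fun_iff split_beta by (simp add: Ball_def) blast
  \<comment> \<open>One inclusion is automatic because chart domains are open; hence the equivalence
    is available only under the chart condition.\<close>
  have cover: "(\<Union>(D, \<phi>) \<in> atlas M. D) = topspace (points M) \<longleftrightarrow>
      (\<forall>x \<in> topspace (points M). \<exists>D \<phi>. (D, \<phi>) \<in> atlas M \<and> x \<in> D)"
    if "\<forall>D \<phi>. (D, \<phi>) \<in> atlas M \<longrightarrow> is_chart (points M) D \<phi>"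
  proof -
    have "D \<subseteq> topspace (points M)" if "(D, \<phi>) \<in> atlas M" for D \<phi>
      using that \<open>\<forall>D \<phi>. _ D \<phi>\<close> by (meson is_chart_iff openin_subset)
    then have "(\<Union>(D, \<phi>) \<in> atlas M. D) \<subseteq> topspace (points M)"
      by fast
    then have "(\<Union>(D, \<phi>) \<in> atlas M. D) = topspace (points M) \<longleftrightarrow>
        topspace (points M) \<subseteq> (\<Union>(D, \<phi>) \<in> atlas M. D)"
      by blast
    also have "\<dots> \<longleftrightarrow> (\<forall>x \<in> topspace (points M). \<exists>D \<phi>. (D, \<phi>) \<in> atlas M \<and> x \<in> D)"
      by fastforce
    finally show ?thesis .
  qed
  show ?thesis
    unfolding complex_manifold_def charts trans using cover by meson
qed

lemma complex_manifoldD: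
  assumes "complex_manifold M"
  shows "Hausdorff_space (points M)" "second_countable (points M)"
    and "(D, \<phi>) \<in> atlas M \<Longrightarrow> is_chart (points M) D \<phi>"
    and "x \<in> topspace (points M) \<Longrightarrow> \<exists>D \<phi>. (D, \<phi>) \<in> atlas M \<and> x \<in> D"
    and "(D, \<phi>) \<in> atlas M \<Longrightarrow> (E, \<psi>) \<in> atlas M \<Longrightarrow> x \<in> D \<Longrightarrow> x \<in> E \<Longrightarrow>
      cdifferentiable (\<psi> \<circ> inv_into D \<phi>) (\<phi> x)"
  using assms unfolding complex_manifold_iff by simp_all

lemma complex_manifoldI:
  assumes "Hausdorff_space (points M)" "second_countable (points M)"
    and "\<And>D \<phi>. (D, \<phi>) \<in> atlas M \<Longrightarrow> is_chart (points M) D \<phi>"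
    and "\<And>x. x \<in> topspace (points M) \<Longrightarrow> \<exists>D \<phi>. (D, \<phi>) \<in> atlas M \<and> x \<in> D"
    and "\<And>D \<phi> E \<psi> x. (D, \<phi>) \<in> atlas M \<Longrightarrow> (E, \<psi>) \<in> atlas M \<Longrightarrow> x \<in> D \<Longrightarrow> x \<in> E \<Longrightarrow>
      cdifferentiable (\<psi> \<circ> inv_into D \<phi>) (\<phi> x)"
  shows "complex_manifold M"
  using assms unfolding complex_manifold_iff by simp

lemma complex_manifold_domain:
  assumes "complex_manifold M" "(D, \<phi>) \<in> atlas M"
  shows "openin (points M) D" "D \<subseteq> topspace (points M)" "inj_on \<phi> D"
  using complex_manifoldD(3)[OF assms] by (auto simp: is_chart_iff dest: openin_subset)

lemma holomorphic_map_iff: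
  "holomorphic_map M N f \<longleftrightarrow> continuous_map (points M) (points N) f \<and>
    (\<forall>D \<phi> E \<psi> x. (D, \<phi>) \<in> atlas M \<longrightarrow> (E, \<psi>) \<in> atlas N \<longrightarrow> x \<in> D \<longrightarrow> f x \<in> E \<longrightarrow>
      cdifferentiable (\<psi> \<circ> f \<circ> inv_into D \<phi>) (\<phi> x))"
  unfolding holomorphic_map_def holomorphic_fun_iff split_beta
  by (simp add: Ball_def) blast

lemma holomorphic_mapD:
  assumes "holomorphic_map M N f"
  shows "continuous_map (points M) (points N) f"
    and "(D, \<phi>) \<in> atlas M \<Longrightarrow> (E, \<psi>) \<in> atlas N \<Longrightarrow> x \<in> D \<Longrightarrow> f x \<in> E \<Longrightarrow>
      cdifferentiable (\<psi> \<circ> f \<circ> inv_into D \<phi>) (\<phi> x)"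
  using assms unfolding holomorphic_map_iff by simp_all

lemma holomorphic_mapI:
  assumes "continuous_map (points M) (points N) f"
    and "\<And>D \<phi> E \<psi> x. (D, \<phi>) \<in> atlas M \<Longrightarrow> (E, \<psi>) \<in> atlas N \<Longrightarrow> x \<in> D \<Longrightarrow> f x \<in> E \<Longrightarrow>
      cdifferentiable (\<psi> \<circ> f \<circ> inv_into D \<phi>) (\<phi> x)"
  shows "holomorphic_map M N f"
  using assms unfolding holomorphic_map_iff by simp

lemma openin_chart_preimage:
  assumes "complex_manifold M" "(D, \<phi>) \<in> atlas M" "continuous_map (points M) X f" "openin X E"
  shows "openin (points M) (D \<inter> f -` E)"
proof -
  have "D \<inter> f -` E = D \<inter> {x \<in> topspace (points M). f x \<in> E}"
    using complex_manifold_domain[OF assms(1,2)] by auto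
  then show ?thesis
    using complex_manifold_domain[OF assms(1,2)] openin_continuous_map_preimage[OF assms(3,4)]
    by auto
qed

text \<open>The chain rule goes through a chart \<open>C\<close> of \<open>N\<close> around
  \<open>f x\<close>. There \<open>inv_into C \<theta> \<circ> \<theta>\<close> is the identity only
  on \<open>C\<close>, so the composed coordinate expressions agree with that of
  \<open>g \<circ> f\<close> only on the part of \<open>D\<close> that \<open>f\<close> sends into
  \<open>C\<close>; continuity of \<open>f\<close> makes this part open.\<close>

lemma holomorphic_map_compose:
  assumes M: "complex_manifold M" and N: "complex_manifold N"
    and f: "holomorphic_map M N f" and g: "holomorphic_map N P g"
  shows "holomorphic_map M P (g \<circ> f)"
proof (rule holomorphic_mapI)
  show "continuous_map (points M) (points P) (g \<circ> f)"
    using f g by (blast intro: continuous_map_compose holomorphic_mapD)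
next
  fix D \<phi> E \<psi> x
  assume D: "(D, \<phi>) \<in> atlas M" and E: "(E, \<psi>) \<in> atlas P" and x: "x \<in> D" "(g \<circ> f) x \<in> E"
  have "f x \<in> topspace (points N)"
    using complex_manifold_domain[OF M D] x holomorphic_mapD(1)[OF f]
    by (auto simp: continuous_map_def)
  then obtain C \<theta> where C: "(C, \<theta>) \<in> atlas N" "f x \<in> C"
    using complex_manifoldD(4)[OF N] by blast
  have inj: "inj_on \<phi> D" "inj_on \<theta> C"
    using complex_manifold_domain M N D C by blast+
  have "cdifferentiable (\<theta> \<circ> f \<circ> inv_into D \<phi>) (\<phi> x)"
    using holomorphic_mapD(2)[OF f D C(1) x(1) C(2)] .
  moreover have "cdifferentiable (\<psi> \<circ> g \<circ> inv_into C \<theta>) ((\<theta> \<circ> f \<circ> inv_into D \<phi>) (\<phi> x))"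
    using holomorphic_mapD(2)[OF g C(1) E C(2)] x inj by simp
  ultimately have "cdifferentiable ((\<psi> \<circ> g \<circ> inv_into C \<theta> \<circ> \<theta> \<circ> f) \<circ> inv_into D \<phi>) (\<phi> x)"
    using cdifferentiable_comp by (metis comp_assoc)
  then show "cdifferentiable (\<psi> \<circ> (g \<circ> f) \<circ> inv_into D \<phi>) (\<phi> x)"
  proof (rule cdifferentiable_chart_cong[where S = "D \<inter> f -` C"])
    show "is_chart (points M) D \<phi>"
      using complex_manifoldD(3)[OF M D] .
    show "openin (points M) (D \<inter> f -` C)"
      using openin_chart_preimage[OF M D holomorphic_mapD(1)[OF f] complex_manifold_domain(1)[OF N C(1)]] .
    show "(\<psi> \<circ> g \<circ> inv_into C \<theta> \<circ> \<theta> \<circ> f) y = (\<psi> \<circ> (g \<circ> f)) y" if "y \<in> D \<inter> f -` C" for y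
      using that inj(2) by simp
  qed (use x inj(1) C(2) in simp_all)
qed

lemma holomorphic_map_cong:
  assumes M: "complex_manifold M" and f: "holomorphic_map M N f"
    and eq: "\<And>x. x \<in> topspace (points M) \<Longrightarrow> f x = g x"
  shows "holomorphic_map M N g"
proof (rule holomorphic_mapI)
  show "continuous_map (points M) (points N) g"
    using continuous_map_eq[OF holomorphic_mapD(1)[OF f]] eq by auto
next
  fix D \<phi> E \<psi> x
  assume D: "(D, \<phi>) \<in> atlas M" and E: "(E, \<psi>) \<in> atlas N" and x: "x \<in> D" "g x \<in> E"
  have sub: "D \<subseteq> topspace (points M)" "inj_on \<phi> D" "openin (points M) D"
    using complex_manifold_domain[OF M D] by auto
  have "cdifferentiable ((\<psi> \<circ> f) \<circ> inv_into D \<phi>) (\<phi> x)"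
    using holomorphic_mapD(2)[OF f D E x(1)] x sub eq by auto
  then show "cdifferentiable (\<psi> \<circ> g \<circ> inv_into D \<phi>) (\<phi> x)"
    by (rule cdifferentiable_chart_cong[where S=D, OF _ complex_manifoldD(3)[OF M D]])
      (use sub eq x in auto)
qed

section \<open>Restriction to open subsets and locality of holomorphy\<close>

lemma points_restrict_manifold [simp]:
  "points (restrict_manifold M S) = subtopology (points M) S"
  by (simp add: restrict_manifold_def)

lemma atlas_restrict_manifold:
  "(D, \<phi>) \<in> atlas (restrict_manifold M S) \<longleftrightarrow> (\<exists>C. (C, \<phi>) \<in> atlas M \<and> D = C \<inter> S)"
  by (force simp: restrict_manifold_def)

lemma restrict_restrict_manifold:
  "restrict_manifold (restrict_manifold M S) T = restrict_manifold M (S \<inter> T)"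
  by (simp add: restrict_manifold_def subtopology_subtopology image_image Int_assoc case_prod_beta)

text \<open>Restricted charts keep their map and lose part of their domain, so only the
  \<open>inv_into\<close> in the transition functions has to be exchanged.\<close>

lemma complex_manifold_restrict:
  assumes M: "complex_manifold M" and S: "openin (points M) S"
  shows "complex_manifold (restrict_manifold M S)"
proof (rule complex_manifoldI)
  show "Hausdorff_space (points (restrict_manifold M S))"
    "second_countable (points (restrict_manifold M S))"
    using complex_manifoldD[OF M]
    by (auto intro: Hausdorff_space_subtopology second_countable_subtopology)
next
  fix D \<phi> assume "(D, \<phi>) \<in> atlas (restrict_manifold M S)"
  then show "is_chart (points (restrict_manifold M S)) D \<phi>"
    using complex_manifoldD(3)[OF M] S by (auto simp: atlas_restrict_manifold is_chart_subtopology)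
next
  fix x assume "x \<in> topspace (points (restrict_manifold M S))"
  then show "\<exists>D \<phi>. (D, \<phi>) \<in> atlas (restrict_manifold M S) \<and> x \<in> D"
    using complex_manifoldD(4)[OF M] by (auto simp: atlas_restrict_manifold) blast
next
  fix D \<phi> E \<psi> x
  assume DE: "(D, \<phi>) \<in> atlas (restrict_manifold M S)" "(E, \<psi>) \<in> atlas (restrict_manifold M S)"
    "x \<in> D" "x \<in> E"
  then obtain C B where C: "(C, \<phi>) \<in> atlas M" "D = C \<inter> S" and B: "(B, \<psi>) \<in> atlas M" "E = B \<inter> S"
    by (auto simp: atlas_restrict_manifold)
  have "cdifferentiable (\<psi> \<circ> inv_into C \<phi>) (\<phi> x)"
    using complex_manifoldD(5)[OF M C(1) B(1)] DE C B by auto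
  then show "cdifferentiable (\<psi> \<circ> inv_into D \<phi>) (\<phi> x)"
    by (rule cdifferentiable_chart_cong[where S=D, OF _ complex_manifoldD(3)[OF M C(1)]])
      (use complex_manifold_domain[OF M C(1)] C S DE in \<open>auto intro: inj_on_subset\<close>)
qed

lemma holomorphic_map_restrict_source:
  assumes M: "complex_manifold M" and f: "holomorphic_map M N f" and S: "openin (points M) S"
  shows "holomorphic_map (restrict_manifold M S) N f"
proof (rule holomorphic_mapI)
  show "continuous_map (points (restrict_manifold M S)) (points N) f"
    using holomorphic_mapD(1)[OF f] by (simp add: continuous_map_from_subtopology)
next
  fix D \<phi> E \<psi> x
  assume DE: "(D, \<phi>) \<in> atlas (restrict_manifold M S)" "(E, \<psi>) \<in> atlas N" "x \<in> D" "f x \<in> E"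
  then obtain C where C: "(C, \<phi>) \<in> atlas M" "D = C \<inter> S"
    by (auto simp: atlas_restrict_manifold)
  have "cdifferentiable (\<psi> \<circ> f \<circ> inv_into C \<phi>) (\<phi> x)"
    using holomorphic_mapD(2)[OF f C(1) DE(2)] DE C by auto
  then show "cdifferentiable (\<psi> \<circ> f \<circ> inv_into D \<phi>) (\<phi> x)"
    by (rule cdifferentiable_chart_cong[where S=D, OF _ complex_manifoldD(3)[OF M C(1)]])
      (use complex_manifold_domain[OF M C(1)] C S DE in \<open>auto intro: inj_on_subset\<close>)
qed

lemma holomorphic_map_restrict_target:
  assumes f: "holomorphic_map M N f" and T: "f ` topspace (points M) \<subseteq> T"
  shows "holomorphic_map M (restrict_manifold N T) f"
  using T holomorphic_mapD[OF f]
  by (intro holomorphic_mapI)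
    (auto simp: continuous_map_in_subtopology atlas_restrict_manifold image_subset_iff)

text \<open>Continuity into the subtopology already forces the values into \<open>T\<close>, so near
  \<open>f x\<close> the charts \<open>E\<close> and \<open>E \<inter> T\<close>, which share their
  map, are interchangeable.\<close>

lemma holomorphic_map_into_restrict:
  assumes M: "complex_manifold M" and f: "holomorphic_map M (restrict_manifold N T) f"
  shows "holomorphic_map M N f"
proof (rule holomorphic_mapI)
  have c: "continuous_map (points M) (subtopology (points N) T) f"
    using holomorphic_mapD(1)[OF f] by simp
  then show "continuous_map (points M) (points N) f"
    by (simp add: continuous_map_into_fulltopology)
  fix D \<phi> E \<psi> x
  assume DE: "(D, \<phi>) \<in> atlas M" "(E, \<psi>) \<in> atlas N" "x \<in> D" "f x \<in> E"
  have "f x \<in> T"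
    using c DE(3) complex_manifold_domain[OF M DE(1)] by (auto simp: continuous_map_def)
  then show "cdifferentiable (\<psi> \<circ> f \<circ> inv_into D \<phi>) (\<phi> x)"
    using holomorphic_mapD(2)[OF f DE(1), of "E \<inter> T" \<psi> x] DE
    by (auto simp: atlas_restrict_manifold)
qed

lemma holomorphic_map_restrict:
  assumes "complex_manifold M" "holomorphic_map M N f" "openin (points M) S"
    and "f ` S \<subseteq> T"
  shows "holomorphic_map (restrict_manifold M S) (restrict_manifold N T) f"
  using assms by (intro holomorphic_map_restrict_target holomorphic_map_restrict_source) auto

text \<open>This is how the projection of the glued bundle is seen to be holomorphic: it is checked
  on the two open pieces.\<close>

lemma holomorphic_map_local:
  assumes M: "complex_manifold M"
    and loc: "\<And>x. x \<in> topspace (points M) \<Longrightarrow>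
      \<exists>S. openin (points M) S \<and> x \<in> S \<and> holomorphic_map (restrict_manifold M S) N f"
  shows "holomorphic_map M N f"
proof (rule holomorphic_mapI)
  show "continuous_map (points M) (points N) f"
  \<comment> \<open>All pieces carry the same function \<open>f\<close>, so agreement on overlaps is
    trivial and the index set can consist of all suitable open sets.\<close>
  proof (rule pasting_lemma[where I = "{S. openin (points M) S \<and>
        continuous_map (subtopology (points M) S) (points N) f}" and T = "\<lambda>S. S" and f = "\<lambda>_. f"])
    fix x assume "x \<in> topspace (points M)"
    then show "\<exists>S. S \<in> {S. openin (points M) S \<and>
        continuous_map (subtopology (points M) S) (points N) f} \<and> x \<in> S \<and> f x = f x"
      using loc holomorphic_mapD(1) by fastforce
  qed auto
next
  fix D \<phi> E \<psi> x
  assume DE: "(D, \<phi>) \<in> atlas M" "(E, \<psi>) \<in> atlas N" "x \<in> D" "f x \<in> E"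
  then obtain S where S: "openin (points M) S" "x \<in> S"
      and h: "holomorphic_map (restrict_manifold M S) N f"
    using loc complex_manifold_domain[OF M DE(1)] by blast
  have "(D \<inter> S, \<phi>) \<in> atlas (restrict_manifold M S)"
    using DE by (auto simp: atlas_restrict_manifold)
  then have "cdifferentiable (\<psi> \<circ> f \<circ> inv_into (D \<inter> S) \<phi>) (\<phi> x)"
    using holomorphic_mapD(2)[OF h] DE S by auto
  moreover have "is_chart (points M) (D \<inter> S) \<phi>"
    using complex_manifoldD(3)[OF M DE(1)] S openin_trans_full
    by (auto simp: is_chart_iff Int_assoc Int_left_commute[of D S] intro: inj_on_subset)
  ultimately show "cdifferentiable (\<psi> \<circ> f \<circ> inv_into D \<phi>) (\<phi> x)"
    by (rule cdifferentiable_chart_cong[where S="D \<inter> S"])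
      (use complex_manifold_domain[OF M DE(1)] DE S in auto)
qed

section \<open>Open subsets of the model space\<close>

lemma second_countable_euclidean:
  "second_countable (euclidean :: 'm::second_countable_topology topology)"
proof -
  obtain B :: "'m set set" where "countable B" "topological_basis B"
    using ex_countable_basis by blast
  then show ?thesis
    unfolding second_countable_def
  proof (intro exI[of _ B] conjI ballI allI impI)
    show "openin euclidean V" if "V \<in> B" for V
      using that \<open>topological_basis B\<close> by (simp add: topological_basis_open)
    show "\<exists>V\<in>B. x \<in> V \<and> V \<subseteq> U" if "openin euclidean U \<and> x \<in> U" for U x
      using that \<open>topological_basis B\<close> by (metis open_openin topological_basisE)
  qed
qed

lemma complex_manifold_open_manifold:
  fixes W :: "'m::{complex_normed_vector, second_countable_topology} set"
  assumes "open W"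
  shows "complex_manifold (open_manifold W)"
proof (rule complex_manifoldI)
  show "second_countable (points (open_manifold W))"
    by (simp add: open_manifold_def second_countable_subtopology second_countable_euclidean)
  show "Hausdorff_space (points (open_manifold W))"
    by (simp add: open_manifold_def Hausdorff_space_subtopology)
next
  fix D \<phi> assume "(D, \<phi>) \<in> atlas (open_manifold W)"
  then have "D = W" "\<phi> = (\<lambda>x. x)"
    by (auto simp: open_manifold_def)
  moreover have "openin (top_of_set W) (W \<inter> (\<lambda>x. x) -` A)" if "open A" for A
    using that by auto
  moreover have "open S" if "openin (top_of_set W) S" for S
    using that assms openin_open_eq by blast
  ultimately show "is_chart (points (open_manifold W)) D \<phi>"
    by (simp add: open_manifold_def is_chart_iff)
next
  fix D \<phi> E \<psi> x
  assume "(D, \<phi>) \<in> atlas (open_manifold W)" "(E, \<psi>) \<in> atlas (open_manifold W)" "x \<in> D" "x \<in> E"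
  then have eq: "\<phi> = (\<lambda>x. x)" "\<psi> = (\<lambda>x. x)" "D = W" and "x \<in> W"
    by (auto simp: open_manifold_def)
  \<comment> \<open>The only transition function is the identity on \<open>W\<close> but arbitrary
    outside; openness of \<open>W\<close> makes that harmless.\<close>
  have "inv_into W (\<lambda>x. x) y = y" if "y \<in> W" for y
    using inv_into_f_f[of "\<lambda>x. x" W y] that by (simp add: inj_on_def)
  then have "cdifferentiable (inv_into W (\<lambda>x. x)) x"
    using cdifferentiable_cong[OF cdifferentiable_id assms \<open>x \<in> W\<close>] by simp
  then show "cdifferentiable (\<psi> \<circ> inv_into D \<phi>) (\<phi> x)"
    by (simp add: eq comp_def)
next
  fix x assume "x \<in> topspace (points (open_manifold W))"
  then show "\<exists>D \<phi>. (D, \<phi>) \<in> atlas (open_manifold W) \<and> x \<in> D"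
    by (simp add: open_manifold_def)
qed

text \<open>Lets a projection to a smaller base be read as one to \<open>U \<union> V\<close> with
  restricted target.\<close>

lemma open_manifold_subset:
  "U \<subseteq> W \<Longrightarrow> open_manifold U = restrict_manifold (open_manifold W) U"
  by (simp add: open_manifold_def restrict_manifold_def subtopology_subtopology Int_absorb1)

section \<open>Biholomorphic maps with a chosen inverse\<close>

text \<open>Naming the inverse allows it to be restricted, composed and, in the gluing, used to
  define an embedding.\<close>

definition biholomorphic_maps ::
    "('a, 'm::complex_normed_vector) manifold_data \<Rightarrow>
     ('b, 'k::complex_normed_vector) manifold_data \<Rightarrow> ('a \<Rightarrow> 'b) \<Rightarrow> ('b \<Rightarrow> 'a) \<Rightarrow> bool"
  where "biholomorphic_maps M N f g \<longleftrightarrow> holomorphic_map M N f \<and> holomorphic_map N M g \<and>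
    (\<forall>x \<in> topspace (points M). g (f x) = x) \<and> (\<forall>y \<in> topspace (points N). f (g y) = y)"

lemma biholomorphic_map_iff: "biholomorphic_map M N f \<longleftrightarrow> (\<exists>g. biholomorphic_maps M N f g)"
  by (auto simp: biholomorphic_map_def biholomorphic_maps_def)

lemma biholomorphic_mapsD:
  assumes "biholomorphic_maps M N f g"
  shows "holomorphic_map M N f" "holomorphic_map N M g"
  using assms by (simp_all add: biholomorphic_maps_def)

lemma biholomorphic_maps_sym: "biholomorphic_maps M N f g \<Longrightarrow> biholomorphic_maps N M g f"
  by (auto simp: biholomorphic_maps_def)

lemma holomorphic_map_in_topspace:
  "holomorphic_map M N f \<Longrightarrow> x \<in> topspace (points M) \<Longrightarrow> f x \<in> topspace (points N)"
  by (auto simp: holomorphic_map_iff continuous_map_def)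

lemma biholomorphic_maps_compose:
  assumes "complex_manifold M" "complex_manifold N" "complex_manifold P"
    and fg: "biholomorphic_maps M N f g" and hk: "biholomorphic_maps N P h k"
  shows "biholomorphic_maps M P (h \<circ> f) (g \<circ> k)"
  using assms unfolding biholomorphic_maps_def
  by (auto intro: holomorphic_map_compose simp: holomorphic_map_in_topspace)

lemma biholomorphic_maps_restrict:
  assumes "complex_manifold M" "complex_manifold N" and fg: "biholomorphic_maps M N f g"
    and "openin (points M) S" "openin (points N) T" "f ` S \<subseteq> T" "g ` T \<subseteq> S"
  shows "biholomorphic_maps (restrict_manifold M S) (restrict_manifold N T) f g"
  using assms unfolding biholomorphic_maps_def
  by (auto intro: holomorphic_map_restrict)

section \<open>Transport of a manifold along an injection\<close>

text \<open>Transport of structure, meaningful when \<open>a\<close> is injective on the points: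
  topology and charts are both pulled back along the inverse of \<open>a\<close> on its
  image.\<close>

definition push_manifold :: "('a \<Rightarrow> 'b) \<Rightarrow> ('a, 'm) manifold_data \<Rightarrow> ('b, 'm) manifold_data"
  where "push_manifold a M =
    \<lparr>points = pullback_topology (a ` topspace (points M)) (inv_into (topspace (points M)) a)
       (points M),
     atlas = (\<lambda>(D, \<phi>). (a ` D, \<phi> \<circ> inv_into (topspace (points M)) a)) ` atlas M\<rparr>"

lemma openin_push_manifold:
  assumes inj: "inj_on a (topspace (points M))"
  shows "openin (points (push_manifold a M)) S \<longleftrightarrow> (\<exists>A. openin (points M) A \<and> S = a ` A)"
proof -
  let ?T = "topspace (points M)"
  have "inv_into ?T a -` A \<inter> a ` ?T = a ` A" if "openin (points M) A" for A
    using openin_subset[OF that] inj by auto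
  then show ?thesis
    unfolding push_manifold_def by (simp add: openin_pullback_topology) metis
qed

lemma topspace_push_manifold:
  assumes inj: "inj_on a (topspace (points M))"
  shows "topspace (points (push_manifold a M)) = a ` topspace (points M)"
proof
  show "topspace (points (push_manifold a M)) \<subseteq> a ` topspace (points M)"
    using openin_push_manifold[OF inj, of "topspace (points (push_manifold a M))"]
    by (metis image_mono openin_subset openin_topspace)
  show "a ` topspace (points M) \<subseteq> topspace (points (push_manifold a M))"
    using openin_push_manifold[OF inj] openin_subset openin_topspace by metis
qed

lemma homeomorphic_map_push_manifold:
  assumes inj: "inj_on a (topspace (points M))"
  shows "homeomorphic_map (points M) (points (push_manifold a M)) a"
proof (rule bijective_open_imp_homeomorphic_map)
  show "continuous_map (points M) (points (push_manifold a M)) a"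
    unfolding continuous_map
  proof (intro conjI allI impI)
    show "a ` topspace (points M) \<subseteq> topspace (points (push_manifold a M))"
      using topspace_push_manifold[OF inj] by simp
    fix S assume "openin (points (push_manifold a M)) S"
    then obtain A where A: "openin (points M) A" "S = a ` A"
      using openin_push_manifold[OF inj] by blast
    then have "{x \<in> topspace (points M). a x \<in> S} = A"
      using openin_subset[OF A(1)] inj by (auto simp: inj_on_def)
    then show "openin (points M) {x \<in> topspace (points M). a x \<in> S}"
      using A by simp
  qed
  show "open_map (points M) (points (push_manifold a M)) a"
    using openin_push_manifold[OF inj] by (auto simp: open_map_def)
qed (use inj topspace_push_manifold[OF inj] in auto)

lemma atlas_push_manifold:
  "(E, \<psi>) \<in> atlas (push_manifold a M) \<longleftrightarrow>
    (\<exists>D \<phi>. (D, \<phi>) \<in> atlas M \<and> E = a ` D \<and> \<psi> = \<phi> \<circ> inv_into (topspace (points M)) a)"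
  by (force simp: push_manifold_def)

lemma inv_into_push_chart:
  assumes inj: "inj_on a T" and D: "D \<subseteq> T" "inj_on \<phi> D" and x: "x \<in> D"
  shows "inv_into (a ` D) (\<phi> \<circ> inv_into T a) (\<phi> x) = a x"
proof -
  have "inj_on (\<phi> \<circ> inv_into T a) (a ` D)"
    using inj D by (auto simp: inj_on_def subset_iff)
  moreover have "(\<phi> \<circ> inv_into T a) (a x) = \<phi> x"
    using inj D x by auto
  ultimately show ?thesis
    using x by (metis image_eqI inv_into_f_f)
qed

text \<open>The inverse of the transported chart is \<open>a\<close> after the inverse of the
  original one, on the whole open image of \<open>D\<close>. Any function on the transported
  manifold can thus be tested in a chart of \<open>M\<close>.\<close>

lemma cdifferentiable_push_chart:
  assumes M: "complex_manifold M" and inj: "inj_on a (topspace (points M))"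
    and D: "(D, \<phi>) \<in> atlas M" and x: "x \<in> D"
  shows "cdifferentiable (F \<circ> inv_into (a ` D) (\<phi> \<circ> inv_into (topspace (points M)) a)) (\<phi> x) \<longleftrightarrow>
    cdifferentiable (F \<circ> a \<circ> inv_into D \<phi>) (\<phi> x)"
proof -
  let ?f = "F \<circ> inv_into (a ` D) (\<phi> \<circ> inv_into (topspace (points M)) a)"
  let ?g = "F \<circ> a \<circ> inv_into D \<phi>"
  have sub: "D \<subseteq> topspace (points M)" "inj_on \<phi> D"
    using complex_manifold_domain[OF M D] by auto
  have eq: "?f z = ?g z" if "z \<in> \<phi> ` D" for z
    using that inv_into_push_chart[OF inj sub] sub(2) by auto
  have op: "open (\<phi> ` D)" and x': "\<phi> x \<in> \<phi> ` D"
    using complex_manifoldD(3)[OF M D] x by (auto simp: is_chart_iff)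
  show ?thesis
    using cdifferentiable_cong[OF _ op x'] eq by metis
qed

text \<open>Topological axioms pass along the homeomorphism \<open>a\<close>. In a transition
  function the inverse of \<open>a\<close> in one chart cancels the \<open>a\<close> from the other,
  which leaves a transition function of \<open>M\<close>.\<close>

lemma complex_manifold_push:
  assumes M: "complex_manifold M" and inj: "inj_on a (topspace (points M))"
  shows "complex_manifold (push_manifold a M)"
proof (rule complex_manifoldI)
  let ?T = "topspace (points M)"
  have "points M homeomorphic_space points (push_manifold a M)"
    using homeomorphic_map_push_manifold[OF inj] by (rule homeomorphic_map_imp_homeomorphic_space)
  then show "Hausdorff_space (points (push_manifold a M))"
    "second_countable (points (push_manifold a M))"
    using complex_manifoldD(1,2)[OF M] homeomorphic_Hausdorff_space
      homeomorphic_space_second_countability by blast+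
  show "is_chart (points (push_manifold a M)) E \<psi>" 
    if E\<psi>: "(E, \<psi>) \<in> atlas (push_manifold a M)" for E \<psi>
  proof -
    obtain D \<phi> where D: "(D, \<phi>) \<in> atlas M" and E: "E = a ` D" "\<psi> = \<phi> \<circ> inv_into ?T a"
      using E\<psi> unfolding atlas_push_manifold by blast
    have c: "is_chart (points M) D \<phi>" and sub: "D \<subseteq> ?T" "inj_on \<phi> D"
      using complex_manifoldD(3)[OF M D] complex_manifold_domain[OF M D] by auto
    have \<psi>: "\<psi> (a x) = \<phi> x" if "x \<in> D" for x
      using that sub inj E by auto
    have "inj_on \<psi> E"
      using sub \<psi> unfolding E(1) by (auto simp: inj_on_def)
    moreover have "open (\<psi> ` S)" if S: "openin (points (push_manifold a M)) S" "S \<subseteq> E" for S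
    proof -
      obtain A where A: "openin (points M) A" "S = a ` A"
        using S(1) openin_push_manifold[OF inj] by blast
      have "A \<subseteq> D"
        using S(2) openin_subset[OF A(1)] sub(1) inj unfolding A(2) E(1)
        by (simp add: inj_on_image_subset_iff)
      then have "\<psi> ` S = \<phi> ` A"
        unfolding A(2) image_image by (intro image_cong) (auto simp: \<psi>)
      then show ?thesis
        using c A(1) \<open>A \<subseteq> D\<close> by (simp add: is_chart_iff)
    qed
    moreover have "openin (points (push_manifold a M)) (E \<inter> \<psi> -` W)" if "open W" for W
    proof -
      have "E \<inter> \<psi> -` W = a ` (D \<inter> \<phi> -` W)"
        using \<psi> unfolding E(1) by auto
      then show ?thesis
        using c that openin_push_manifold[OF inj] by (auto simp: is_chart_iff)
    qed
    moreover have "openin (points (push_manifold a M)) E"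
      using c openin_push_manifold[OF inj] E(1) by (auto simp: is_chart_iff)
    ultimately show ?thesis
      by (simp add: is_chart_iff)
  qed
  show "\<exists>E \<psi>. (E, \<psi>) \<in> atlas (push_manifold a M) \<and> y \<in> E"
    if y: "y \<in> topspace (points (push_manifold a M))" for y
  proof -
    obtain x where "x \<in> ?T" "y = a x"
      using y topspace_push_manifold[OF inj] by auto
    then show ?thesis
      using complex_manifoldD(4)[OF M] atlas_push_manifold[of _ _ a M] by blast
  qed
  show "cdifferentiable (\<psi>' \<circ> inv_into E \<psi>) (\<psi> y)"
    if EE: "(E, \<psi>) \<in> atlas (push_manifold a M)" "(E', \<psi>') \<in> atlas (push_manifold a M)"
      and y: "y \<in> E" "y \<in> E'" for E \<psi> E' \<psi>' y
  proof -
    obtain D \<phi> where D: "(D, \<phi>) \<in> atlas M" and E: "E = a ` D" "\<psi> = \<phi> \<circ> inv_into ?T a"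
      using EE unfolding atlas_push_manifold by blast
    obtain D' \<phi>' where D': "(D', \<phi>') \<in> atlas M" and E': "E' = a ` D'" "\<psi>' = \<phi>' \<circ> inv_into ?T a"
      using EE unfolding atlas_push_manifold by blast
    have sub: "D \<subseteq> ?T" "D' \<subseteq> ?T"
      using complex_manifold_domain M D D' by blast+
    obtain x where x: "x \<in> D" "y = a x"
      using y E(1) by blast
    have "x \<in> D'"
      using y(2) x sub inj unfolding E'(1) by (simp add: inj_on_image_mem_iff subset_iff)
    have "\<psi> y = \<phi> x"
      using x sub inj by (auto simp: E)
    have "cdifferentiable (\<phi>' \<circ> inv_into D \<phi>) (\<phi> x)"
      using complex_manifoldD(5)[OF M D D' x(1) \<open>x \<in> D'\<close>] .
    then have "cdifferentiable (\<psi>' \<circ> a \<circ> inv_into D \<phi>) (\<phi> x)"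
      by (rule cdifferentiable_chart_cong[where S = D, OF _ complex_manifoldD(3)[OF M D]])
        (use complex_manifold_domain[OF M D] inj x in \<open>auto simp: E'\<close>)
    then show ?thesis
      unfolding \<open>\<psi> y = \<phi> x\<close> unfolding E by (simp add: cdifferentiable_push_chart[OF M inj D x(1)])
  qed
qed

text \<open>By the same cancellation, both \<open>a\<close> and its inverse look in charts like
  transition functions of \<open>M\<close>.\<close>

lemma biholomorphic_maps_push:
  assumes M: "complex_manifold M" and inj: "inj_on a (topspace (points M))"
  shows "biholomorphic_maps M (push_manifold a M) a (inv_into (topspace (points M)) a)"
proof -
  let ?T = "topspace (points M)"
  have hom: "homeomorphic_maps (points M) (points (push_manifold a M)) a (inv_into ?T a)"
  proof -
    \<comment> \<open>The inverse \<open>b\<close> is anonymous; it agrees with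
      \<open>inv_into ?T a\<close> on the image of \<open>a\<close> and may be replaced by
      it.\<close>
    obtain b where b: "homeomorphic_maps (points M) (points (push_manifold a M)) a b"
      using homeomorphic_map_push_manifold[OF inj] homeomorphic_map_maps by blast
    then show ?thesis
      by (rule homeomorphic_maps_eq)
        (use b topspace_push_manifold[OF inj] inj in \<open>auto simp: homeomorphic_maps_def\<close>)
  qed
  have "holomorphic_map M (push_manifold a M) a"
  proof (rule holomorphic_mapI)
    show "continuous_map (points M) (points (push_manifold a M)) a"
      using hom by (simp add: homeomorphic_maps_def)
    fix D \<phi> E \<psi> x
    assume D: "(D, \<phi>) \<in> atlas M" and "(E, \<psi>) \<in> atlas (push_manifold a M)" and x: "x \<in> D" "a x \<in> E"
    then obtain D' \<phi>' where D': "(D', \<phi>') \<in> atlas M" and E: "E = a ` D'" "\<psi> = \<phi>' \<circ> inv_into ?T a"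
      by (auto simp: atlas_push_manifold)
    have "x \<in> D'"
      using x E inj complex_manifold_domain(2)[OF M D] complex_manifold_domain(2)[OF M D']
      by (auto simp: inj_on_image_mem_iff subset_iff)
    have "cdifferentiable (\<phi>' \<circ> inv_into D \<phi>) (\<phi> x)"
      using complex_manifoldD(5)[OF M D D' x(1) \<open>x \<in> D'\<close>] .
    then show "cdifferentiable (\<psi> \<circ> a \<circ> inv_into D \<phi>) (\<phi> x)"
      by (rule cdifferentiable_chart_cong[where S = D, OF _ complex_manifoldD(3)[OF M D]])
        (use complex_manifold_domain[OF M D] inj x in \<open>auto simp: E\<close>)
  qed
  moreover have "holomorphic_map (push_manifold a M) M (inv_into ?T a)"
  proof (rule holomorphic_mapI)
    show "continuous_map (points (push_manifold a M)) (points M) (inv_into ?T a)"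
      using hom by (simp add: homeomorphic_maps_def)
    fix E \<psi> D' \<phi>' y
    assume "(E, \<psi>) \<in> atlas (push_manifold a M)" and D': "(D', \<phi>') \<in> atlas M"
      and y: "y \<in> E" "inv_into ?T a y \<in> D'"
    then obtain D \<phi> where D: "(D, \<phi>) \<in> atlas M" and E: "E = a ` D" "\<psi> = \<phi> \<circ> inv_into ?T a"
      by (auto simp: atlas_push_manifold)
    have sub: "D \<subseteq> ?T"
      using complex_manifold_domain(2)[OF M D] .
    obtain x where x: "x \<in> D" "y = a x" "x \<in> D'"
      using y sub inj unfolding E(1) by auto
    have "\<psi> y = \<phi> x"
      using x sub inj by (auto simp: E)
    have "cdifferentiable (\<phi>' \<circ> inv_into D \<phi>) (\<phi> x)"
      using complex_manifoldD(5)[OF M D D' x(1,3)] .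
    then have "cdifferentiable (\<phi>' \<circ> inv_into ?T a \<circ> a \<circ> inv_into D \<phi>) (\<phi> x)"
      by (rule cdifferentiable_chart_cong[where S = D, OF _ complex_manifoldD(3)[OF M D]])
        (use complex_manifold_domain[OF M D] inj x in auto)
    then show "cdifferentiable (\<phi>' \<circ> inv_into ?T a \<circ> inv_into E \<psi>) (\<psi> y)"
      unfolding \<open>\<psi> y = \<phi> x\<close> unfolding E by (simp add: cdifferentiable_push_chart[OF M inj D x(1)])
  qed
  ultimately show ?thesis
    using inj topspace_push_manifold[OF inj] by (auto simp: biholomorphic_maps_def)
qed

section \<open>Unions of compatible manifolds\<close>

text \<open>The final topology for the two inclusions. In general the pieces need not be open in it
  nor keep their own topologies; that is what compatibility on the overlap will ensure.\<close>

definition union_topology :: "'a topology \<Rightarrow> 'a topology \<Rightarrow> 'a topology"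
  where "union_topology X Y = topology (\<lambda>A. A \<subseteq> topspace X \<union> topspace Y \<and>
    openin X (A \<inter> topspace X) \<and> openin Y (A \<inter> topspace Y))"

lemma openin_union_topology:
  "openin (union_topology X Y) A \<longleftrightarrow> A \<subseteq> topspace X \<union> topspace Y \<and>
    openin X (A \<inter> topspace X) \<and> openin Y (A \<inter> topspace Y)"
proof -
  have "istopology (\<lambda>A. A \<subseteq> topspace X \<union> topspace Y \<and>
      openin X (A \<inter> topspace X) \<and> openin Y (A \<inter> topspace Y))"
    unfolding istopology_def
  proof (intro conjI allI impI)
    fix A B
    assume A: "A \<subseteq> topspace X \<union> topspace Y \<and> openin X (A \<inter> topspace X) \<and> openin Y (A \<inter> topspace Y)"
      and B: "B \<subseteq> topspace X \<union> topspace Y \<and> openin X (B \<inter> topspace X) \<and> openin Y (B \<inter> topspace Y)"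
    have *: "A \<inter> B \<inter> Z = (A \<inter> Z) \<inter> (B \<inter> Z)" for Z
      by auto
    show "A \<inter> B \<subseteq> topspace X \<union> topspace Y" "openin X (A \<inter> B \<inter> topspace X)"
      "openin Y (A \<inter> B \<inter> topspace Y)"
      using A B unfolding * by auto
  next
    fix K
    assume K: "\<forall>A\<in>K. A \<subseteq> topspace X \<union> topspace Y \<and>
      openin X (A \<inter> topspace X) \<and> openin Y (A \<inter> topspace Y)"
    have *: "\<Union>K \<inter> Z = \<Union>((\<lambda>A. A \<inter> Z) ` K)" for Z
      by auto
    show "\<Union>K \<subseteq> topspace X \<union> topspace Y"
      using K by blast
    show "openin X (\<Union>K \<inter> topspace X)"
      unfolding * by (rule openin_Union) (use K in auto)
    show "openin Y (\<Union>K \<inter> topspace Y)"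
      unfolding * by (rule openin_Union) (use K in auto)
  qed
  then show ?thesis
    by (simp add: union_topology_def topology_inverse')
qed

lemma topspace_union_topology: "topspace (union_topology X Y) = topspace X \<union> topspace Y"
proof
  show "topspace (union_topology X Y) \<subseteq> topspace X \<union> topspace Y"
    using openin_union_topology[of X Y "topspace (union_topology X Y)"] by simp
  have *: "(topspace X \<union> topspace Y) \<inter> topspace X = topspace X"
    "(topspace X \<union> topspace Y) \<inter> topspace Y = topspace Y"
    by auto
  have "openin (union_topology X Y) (topspace X \<union> topspace Y)"
    unfolding openin_union_topology * by simp
  then show "topspace X \<union> topspace Y \<subseteq> topspace (union_topology X Y)"
    by (rule openin_subset)
qed

lemma union_topology_commute: "union_topology X Y = union_topology Y X"
  unfolding topology_eq openin_union_topology by auto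

lemma continuous_map_union_topology:
  assumes "continuous_map X Z f" "continuous_map Y Z f"
  shows "continuous_map (union_topology X Y) Z f"
  unfolding continuous_map
proof (intro conjI allI impI)
  show "f ` topspace (union_topology X Y) \<subseteq> topspace Z"
    using assms by (auto simp: topspace_union_topology continuous_map)
  fix A assume A: "openin Z A"
  have *: "{x \<in> topspace (union_topology X Y). f x \<in> A} \<inter> topspace X = {x \<in> topspace X. f x \<in> A}"
    "{x \<in> topspace (union_topology X Y). f x \<in> A} \<inter> topspace Y = {x \<in> topspace Y. f x \<in> A}"
    by (auto simp: topspace_union_topology)
  show "openin (union_topology X Y) {x \<in> topspace (union_topology X Y). f x \<in> A}"
    unfolding openin_union_topology * using assms A
    by (auto simp: continuous_map topspace_union_topology)
qed

text \<open>The union of two countable bases works: sets open in an open piece are open in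
  \<open>X\<close>, and a neighbourhood \<open>U\<close> of a point of \<open>S\<close> is first cut
  down to \<open>U \<inter> S\<close>.\<close>

lemma second_countable_open_cover:
  assumes "openin X S" "openin X T" "S \<union> T = topspace X"
    and "second_countable (subtopology X S)" "second_countable (subtopology X T)"
  shows "second_countable X"
proof -
  have *: "\<exists>B. countable B \<and> (\<forall>V\<in>B. openin X V) \<and>
      (\<forall>U x. openin X U \<and> x \<in> U \<and> x \<in> S \<longrightarrow> (\<exists>V\<in>B. x \<in> V \<and> V \<subseteq> U))"
    if S: "openin X S" "second_countable (subtopology X S)" for S
  proof -
    obtain B where B: "countable B" "\<forall>V\<in>B. openin (subtopology X S) V"
      "\<forall>U x. openin (subtopology X S) U \<and> x \<in> U \<longrightarrow> (\<exists>V\<in>B. x \<in> V \<and> V \<subseteq> U)"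
      using S(2) unfolding second_countable_def by blast
    have "\<exists>V\<in>B. x \<in> V \<and> V \<subseteq> U" if "openin X U" "x \<in> U" "x \<in> S" for U x
      using B(3)[rule_format, of "U \<inter> S" x] that by (auto simp: openin_subtopology_Int)
    moreover have "\<forall>V\<in>B. openin X V"
      using B(2) S(1) by (simp add: openin_open_subtopology)
    ultimately show ?thesis
      using B(1) by blast
  qed
  obtain B where B: "countable B" "\<forall>V\<in>B. openin X V"
      "\<forall>U x. openin X U \<and> x \<in> U \<and> x \<in> S \<longrightarrow> (\<exists>V\<in>B. x \<in> V \<and> V \<subseteq> U)"
    using *[OF assms(1,4)] by blast
  obtain C where C: "countable C" "\<forall>V\<in>C. openin X V"
      "\<forall>U x. openin X U \<and> x \<in> U \<and> x \<in> T \<longrightarrow> (\<exists>V\<in>C. x \<in> V \<and> V \<subseteq> U)"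
    using *[OF assms(2,5)] by blast
  have cover: "\<exists>V\<in>B \<union> C. x \<in> V \<and> V \<subseteq> U" if U: "openin X U" "x \<in> U" for U x
  proof -
    consider "x \<in> S" | "x \<in> T"
      using U assms(3) openin_subset by blast
    then show ?thesis
      using B(3)[rule_format, of U x] C(3)[rule_format, of U x] U by cases blast+
  qed
  show ?thesis
    unfolding second_countable_def
  proof (intro exI[of _ "B \<union> C"] conjI)
    show "countable (B \<union> C)" "\<forall>V\<in>B \<union> C. openin X V"
      using B(1,2) C(1,2) by auto
  qed (use cover in blast)
qed

section \<open>Complex structure on a union\<close>

definition manifold_union ::
    "('a, 'm) manifold_data \<Rightarrow> ('a, 'm) manifold_data \<Rightarrow> ('a, 'm) manifold_data"
  where "manifold_union M N =
    \<lparr>points = union_topology (points M) (points N), atlas = atlas M \<union> atlas N\<rparr>"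

lemma manifold_union_commute: "manifold_union M N = manifold_union N M"
  by (simp add: manifold_union_def union_topology_commute Un_commute)

text \<open>One half of the statement that the identity of the overlap is biholomorphic between the
  two structures; the other half is the same condition with \<open>M\<close> and \<open>N\<close>
  exchanged.\<close>

definition compatible_on_overlap ::
    "('a, 'm::complex_normed_vector) manifold_data \<Rightarrow> ('a, 'm) manifold_data \<Rightarrow> bool"
  where "compatible_on_overlap M N \<longleftrightarrow>
    openin (points M) (topspace (points M) \<inter> topspace (points N)) \<and>
    holomorphic_map (restrict_manifold M (topspace (points N))) N (\<lambda>x. x)"

text \<open>Continuity of the identity makes the trace of \<open>A\<close> open in the overlap, and
  the overlap is itself open in \<open>M\<close>.\<close>

lemma openin_compatible:
  assumes "compatible_on_overlap M N" "openin (points N) A"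
  shows "openin (points M) (A \<inter> topspace (points M))"
proof -
  let ?S = "topspace (points M)" and ?T = "topspace (points N)"
  have "continuous_map (subtopology (points M) ?T) (points N) (\<lambda>x. x)"
    using assms(1) holomorphic_mapD(1) by (fastforce simp: compatible_on_overlap_def)
  then have "openin (subtopology (points M) ?T)
      {x \<in> topspace (subtopology (points M) ?T). x \<in> A}"
    using assms(2) openin_continuous_map_preimage by blast
  moreover have "{x \<in> topspace (subtopology (points M) ?T). x \<in> A} = A \<inter> ?S"
    using openin_subset[OF assms(2)] by auto
  ultimately obtain B where B: "openin (points M) B" "A \<inter> ?S = B \<inter> ?T"
    by (auto simp: openin_subtopology)
  then have "A \<inter> ?S = B \<inter> (?S \<inter> ?T)"
    using openin_subset[OF B(1)] by auto
  then show ?thesis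
    using B(1) assms(1) by (auto simp: compatible_on_overlap_def)
qed

lemma topspace_manifold_union:
  "topspace (points (manifold_union M N)) = topspace (points M) \<union> topspace (points N)"
  by (simp add: manifold_union_def topspace_union_topology)

text \<open>An open set of \<open>M\<close> is open in the union if its trace on \<open>N\<close> is
  open in \<open>N\<close>, hence the order \<open>N\<close>, \<open>M\<close> in the compatibility
  assumption. The right-hand versions come from commutativity of the union.\<close>

lemma openin_manifold_union_left:
  assumes "compatible_on_overlap N M" "A \<subseteq> topspace (points M)"
  shows "openin (points (manifold_union M N)) A \<longleftrightarrow> openin (points M) A"
  using assms openin_compatible[OF assms(1)]
  by (auto simp: manifold_union_def openin_union_topology Int_absorb2)

lemma subtopology_manifold_union_left:
  assumes "compatible_on_overlap N M"
  shows "subtopology (points (manifold_union M N)) (topspace (points M)) = points M"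
proof -
  have "openin (points (manifold_union M N)) (topspace (points M))"
    using openin_manifold_union_left[OF assms] by simp
  then show ?thesis
    unfolding topology_eq using openin_manifold_union_left[OF assms] openin_subset
    by (metis openin_open_subtopology)
qed

lemma is_chart_manifold_union_left:
  assumes "compatible_on_overlap N M" "is_chart (points M) D \<phi>"
  shows "is_chart (points (manifold_union M N)) D \<phi>"
proof -
  have D: "D \<subseteq> topspace (points M)"
    using assms(2) by (auto simp: is_chart_iff dest: openin_subset)
  have "openin (points (manifold_union M N)) A \<longleftrightarrow> openin (points M) A" if "A \<subseteq> D" for A
    using openin_manifold_union_left[OF assms(1)] that D by blast
  then show ?thesis
    using assms(2) by (auto simp: is_chart_iff)
qed

text \<open>The transition from a chart of \<open>M\<close> to one of \<open>N\<close> is the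
  coordinate expression of the identity of the overlap. That expression uses the domain cut down to
  the overlap, which is then enlarged back to \<open>D\<close>.\<close>

lemma cdifferentiable_compatible:
  assumes M: "complex_manifold M" and N: "complex_manifold N" and c: "compatible_on_overlap M N"
    and D: "(D, \<phi>) \<in> atlas M" and E: "(E, \<psi>) \<in> atlas N" and x: "x \<in> D" "x \<in> E"
  shows "cdifferentiable (\<psi> \<circ> inv_into D \<phi>) (\<phi> x)"
proof -
  let ?S = "topspace (points M)" and ?T = "topspace (points N)"
  have sub: "D \<subseteq> ?S" "inj_on \<phi> D" "openin (points M) D" "E \<subseteq> ?T"
    using complex_manifold_domain[OF M D] complex_manifold_domain[OF N E] by auto
  have "(D \<inter> ?T, \<phi>) \<in> atlas (restrict_manifold M ?T)"
    using D by (auto simp: atlas_restrict_manifold)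
  then have d: "cdifferentiable (\<psi> \<circ> (\<lambda>x. x) \<circ> inv_into (D \<inter> ?T) \<phi>) (\<phi> x)"
    using c x sub by (intro holomorphic_mapD(2)[OF _ _ E]) (auto simp: compatible_on_overlap_def)
  have op: "openin (points M) (D \<inter> ?T)"
  proof -
    have "D \<inter> ?T = D \<inter> (?S \<inter> ?T)"
      using sub by auto
    then show ?thesis
      using sub c by (auto simp: compatible_on_overlap_def)
  qed
  have "openin (points M) (D \<inter> ?T \<inter> \<phi> -` W)" if "open W" for W
  proof -
    have "openin (points M) ((D \<inter> \<phi> -` W) \<inter> (D \<inter> ?T))"
      using op complex_manifoldD(3)[OF M D] that by (auto simp: is_chart_iff)
    moreover have "(D \<inter> \<phi> -` W) \<inter> (D \<inter> ?T) = D \<inter> ?T \<inter> \<phi> -` W"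
      by auto
    ultimately show ?thesis
      by simp
  qed
  then have "is_chart (points M) (D \<inter> ?T) \<phi>"
    using op complex_manifoldD(3)[OF M D] by (auto simp: is_chart_iff intro: inj_on_subset)
  with d show ?thesis
    by (rule cdifferentiable_chart_cong[where S = "D \<inter> ?T"]) (use sub op x in auto)
qed

text \<open>Mixed transition functions come from the two compatibilities. Hausdorffness does not:
  two copies of the complex line glued off the origin satisfy everything else.\<close>

lemma complex_manifold_union:
  assumes M: "complex_manifold M" and N: "complex_manifold N"
    and MN: "compatible_on_overlap M N" and NM: "compatible_on_overlap N M"
    and H: "Hausdorff_space (points (manifold_union M N))"
  shows "complex_manifold (manifold_union M N)"
proof (rule complex_manifoldI)
  let ?U = "manifold_union M N"
  show "second_countable (points ?U)"
  proof (rule second_countable_open_cover)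
    show "openin (points ?U) (topspace (points M))"
      using openin_manifold_union_left[OF NM] by simp
    show "openin (points ?U) (topspace (points N))"
      using openin_manifold_union_left[OF MN] by (simp add: manifold_union_commute[of M])
    show "topspace (points M) \<union> topspace (points N) = topspace (points ?U)"
      by (simp add: topspace_manifold_union)
    show "second_countable (subtopology (points ?U) (topspace (points M)))"
      using subtopology_manifold_union_left[OF NM] complex_manifoldD(2)[OF M] by simp
    show "second_countable (subtopology (points ?U) (topspace (points N)))"
      using subtopology_manifold_union_left[OF MN] complex_manifoldD(2)[OF N]
      by (simp add: manifold_union_commute[of M])
  qed
  have atlas: "(D, \<phi>) \<in> atlas ?U \<longleftrightarrow> (D, \<phi>) \<in> atlas M \<or> (D, \<phi>) \<in> atlas N" for D \<phi>
    by (simp add: manifold_union_def)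
  show "is_chart (points ?U) D \<phi>" if "(D, \<phi>) \<in> atlas ?U" for D \<phi>
    using that is_chart_manifold_union_left[OF NM complex_manifoldD(3)[OF M], of D \<phi>]
      is_chart_manifold_union_left[OF MN complex_manifoldD(3)[OF N], of D \<phi>]
    unfolding atlas manifold_union_commute[of N M] by blast
  show "\<exists>D \<phi>. (D, \<phi>) \<in> atlas ?U \<and> x \<in> D" if "x \<in> topspace (points ?U)" for x
    using that complex_manifoldD(4)[OF M] complex_manifoldD(4)[OF N]
    unfolding atlas topspace_manifold_union by blast
  show "cdifferentiable (\<psi> \<circ> inv_into D \<phi>) (\<phi> x)"
    if "(D, \<phi>) \<in> atlas ?U" "(E, \<psi>) \<in> atlas ?U" "x \<in> D" "x \<in> E" for D \<phi> E \<psi> x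
    using that complex_manifoldD(5)[OF M] complex_manifoldD(5)[OF N]
      cdifferentiable_compatible[OF M N MN] cdifferentiable_compatible[OF N M NM]
    unfolding atlas by blast
qed (rule H)

text \<open>The piece of the union on the points of \<open>M\<close> also carries the traces of the
  charts of \<open>N\<close>. It is therefore not the same record as \<open>M\<close>, only
  biholomorphic to it by the identity.\<close>

lemma biholomorphic_maps_union_left:
  assumes M: "complex_manifold M" and U: "complex_manifold (manifold_union M N)"
    and NM: "compatible_on_overlap N M"
  shows "biholomorphic_maps (restrict_manifold (manifold_union M N) (topspace (points M))) M
    (\<lambda>x. x) (\<lambda>x. x)"
proof -
  let ?U = "manifold_union M N" and ?S = "topspace (points M)"
  have S: "openin (points ?U) ?S"
    using openin_manifold_union_left[OF NM] by simp
  have sub: "subtopology (points ?U) ?S = points M"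
    using subtopology_manifold_union_left[OF NM] .
  have atlas: "(D, \<phi>) \<in> atlas ?U" if "(D, \<phi>) \<in> atlas M" for D \<phi>
    using that by (simp add: manifold_union_def)
  have trans: "cdifferentiable (\<psi> \<circ> (\<lambda>x. x) \<circ> inv_into D \<phi>) (\<phi> x)"
    if "(D, \<phi>) \<in> atlas ?U" "(E, \<psi>) \<in> atlas ?U" "x \<in> D" "x \<in> E" for D \<phi> E \<psi> x
    using complex_manifoldD(5)[OF U that] by (simp add: comp_def)
  have "holomorphic_map M ?U (\<lambda>x. x)"
  proof (rule holomorphic_mapI)
    have "continuous_map (points M) (subtopology (points ?U) ?S) (\<lambda>x. x)"
      unfolding sub by simp
    then show "continuous_map (points M) (points ?U) (\<lambda>x. x)"
      by (rule continuous_map_into_fulltopology)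
  qed (use atlas trans in blast)
  then have 1: "holomorphic_map M (restrict_manifold ?U ?S) (\<lambda>x. x)"
    by (rule holomorphic_map_restrict_target) simp
  have 2: "holomorphic_map (restrict_manifold ?U ?S) M (\<lambda>x. x)"
  proof (rule holomorphic_mapI)
    show "continuous_map (points (restrict_manifold ?U ?S)) (points M) (\<lambda>x. x)"
      by (simp add: sub)
    fix D \<phi> E \<psi> x
    assume "(D, \<phi>) \<in> atlas (restrict_manifold ?U ?S)" and E: "(E, \<psi>) \<in> atlas M"
      and x: "x \<in> D" "x \<in> E"
    then obtain C where C: "(C, \<phi>) \<in> atlas ?U" "D = C \<inter> ?S"
      by (auto simp: atlas_restrict_manifold)
    show "cdifferentiable (\<psi> \<circ> (\<lambda>x. x) \<circ> inv_into D \<phi>) (\<phi> x)"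
    proof (rule cdifferentiable_chart_cong)
      show "cdifferentiable (\<psi> \<circ> (\<lambda>x. x) \<circ> inv_into C \<phi>) (\<phi> x)"
        using trans[OF C(1) atlas[OF E]] x C by auto
      show "is_chart (points ?U) C \<phi>"
        using complex_manifoldD(3)[OF U C(1)] .
      show "openin (points ?U) (C \<inter> ?S)"
        using complex_manifold_domain(1)[OF U C(1)] S by auto
    qed (use complex_manifold_domain(3)[OF U C(1)] C x in \<open>auto intro: inj_on_subset\<close>)
  qed
  from 1 2 show ?thesis
    by (simp add: biholomorphic_maps_def)
qed

lemma restrict_manifold_Int_topspace:
  assumes "complex_manifold M"
  shows "restrict_manifold M A = restrict_manifold M (topspace (points M) \<inter> A)"
proof -
  have "(\<lambda>(D, \<phi>). (D \<inter> A, \<phi>)) ` atlas M = (\<lambda>(D, \<phi>). (D \<inter> (topspace (points M) \<inter> A), \<phi>)) ` atlas M"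
  proof (rule image_cong[OF refl])
    fix c assume "c \<in> atlas M"
    then have "fst c \<subseteq> topspace (points M)"
      using complex_manifold_domain(2)[OF assms, of "fst c" "snd c"] by simp
    then show "(case c of (D, \<phi>) \<Rightarrow> (D \<inter> A, \<phi>)) =
        (case c of (D, \<phi>) \<Rightarrow> (D \<inter> (topspace (points M) \<inter> A), \<phi>))"
      by (auto simp: split_beta)
  qed
  then show ?thesis
    by (simp add: restrict_manifold_def subtopology_restrict[of "points M" A])
qed

text \<open>The identity is allowed to appear as some \<open>h\<close> that merely agrees with it on
  \<open>S\<close>, typically a composite already known to be holomorphic.\<close>

lemma compatible_on_overlapI:
  assumes M: "complex_manifold M" and N: "complex_manifold N"
    and S: "openin (points M) S" "openin (points N) S" "S = topspace (points M) \<inter> topspace (points N)"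
    and hol: "holomorphic_map (restrict_manifold M S) (restrict_manifold N S) h"
    and h: "\<And>x. x \<in> S \<Longrightarrow> h x = x"
  shows "compatible_on_overlap M N"
proof -
  have MS: "complex_manifold (restrict_manifold M S)"
    using complex_manifold_restrict[OF M S(1)] .
  have "holomorphic_map (restrict_manifold M S) N (\<lambda>x. x)"
    by (rule holomorphic_map_cong[OF MS holomorphic_map_into_restrict[OF MS hol]]) (use h in auto)
  then show ?thesis
    using S restrict_manifold_Int_topspace[OF M, of "topspace (points N)"]
    by (simp add: compatible_on_overlap_def)
qed

text \<open>\<open>sep\<close> excludes the two origins of the doubled line: with the same image
  under \<open>p\<close>, two points of different pieces cannot both lie off the overlap.\<close>

lemma Hausdorff_space_manifold_union:
  assumes M: "complex_manifold M" and N: "complex_manifold N"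
    and MN: "compatible_on_overlap M N" and NM: "compatible_on_overlap N M"
    and cont: "continuous_map (points M) Z p" "continuous_map (points N) Z p"
    and Z: "Hausdorff_space Z"
    and sep: "\<And>x y. x \<in> topspace (points M) \<Longrightarrow> y \<in> topspace (points N) \<Longrightarrow> p x = p y \<Longrightarrow>
      x \<in> topspace (points N) \<or> y \<in> topspace (points M)"
  shows "Hausdorff_space (points (manifold_union M N))"
  unfolding Hausdorff_space_def
proof (intro allI impI)
  let ?X = "points (manifold_union M N)"
  fix x y assume xy: "x \<in> topspace ?X \<and> y \<in> topspace ?X \<and> x \<noteq> y"
  have p: "continuous_map ?X Z p"
    using continuous_map_union_topology[OF cont] by (simp add: manifold_union_def)
  show "\<exists>A B. openin ?X A \<and> openin ?X B \<and> x \<in> A \<and> y \<in> B \<and> disjnt A B"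
  proof (cases "p x = p y")
    case False
    have "p x \<in> topspace Z" "p y \<in> topspace Z"
      using xy p by (auto simp: continuous_map)
    then obtain A B where AB: "openin Z A" "openin Z B" "p x \<in> A" "p y \<in> B" "disjnt A B"
      using False Z unfolding Hausdorff_space_def by blast
    let ?A = "{z \<in> topspace ?X. p z \<in> A}" and ?B = "{z \<in> topspace ?X. p z \<in> B}"
    have "openin ?X ?A" "openin ?X ?B"
      using openin_continuous_map_preimage[OF p] AB by auto
    moreover have "x \<in> ?A" "y \<in> ?B" "disjnt ?A ?B"
      using xy AB by (auto simp: disjnt_iff)
    ultimately show ?thesis
      by blast
  next
    case True
    \<comment> \<open>If the points start in different pieces, \<open>sep\<close> moves one of them
      into the piece of the other.\<close>
    then consider "x \<in> topspace (points M)" "y \<in> topspace (points M)"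
      | "x \<in> topspace (points N)" "y \<in> topspace (points N)"
      using xy sep[of x y] sep[of y x] by (auto simp: topspace_manifold_union)
    then show ?thesis
    proof cases
      case 1
      then obtain A B where AB: "openin (points M) A" "openin (points M) B" "x \<in> A" "y \<in> B" "disjnt A B"
        using xy complex_manifoldD(1)[OF M] unfolding Hausdorff_space_def by meson
      have "openin ?X A" "openin ?X B"
        using AB(1,2) by (simp_all add: openin_manifold_union_left[OF NM] openin_subset)
      then show ?thesis
        using AB(3-5) by blast
    next
      case 2
      then obtain A B where AB: "openin (points N) A" "openin (points N) B" "x \<in> A" "y \<in> B" "disjnt A B"
        using xy complex_manifoldD(1)[OF N] unfolding Hausdorff_space_def by meson
      have "openin ?X A" "openin ?X B"
        using AB(1,2) unfolding manifold_union_commute[of M N]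
        by (simp_all add: openin_manifold_union_left[OF MN] openin_subset)
      then show ?thesis
        using AB(3-5) by blast
    qed
  qed
qed

section \<open>Line bundles\<close>

lemma carrier_complex_field [simp]: "carrier complex_field = UNIV"
  by (simp add: complex_field_def)

lemma complex_linear_compose:
  assumes "complex_linear F G f" "complex_linear G H g"
  shows "complex_linear F H (g \<circ> f)"
  using assms unfolding complex_linear_def by (simp add: Pi_iff)

text \<open>The module axioms enter through closure: sums and multiples must stay in the carrier,
  where \<open>f\<close> and \<open>g\<close> agree.\<close>

lemma complex_linear_cong:
  assumes "module complex_field F" "complex_linear F G f"
    and "\<And>v. v \<in> carrier F \<Longrightarrow> f v = g v"
  shows "complex_linear F G g"
proof -
  interpret F: module complex_field F
    by fact
  show ?thesis
    unfolding complex_linear_def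
  proof (intro conjI ballI allI)
    show "g \<in> carrier F \<rightarrow> carrier G"
      using assms(2,3) by (auto simp: complex_linear_def Pi_iff)
  next
    fix v w assume "v \<in> carrier F" "w \<in> carrier F"
    then show "g (v \<oplus>\<^bsub>F\<^esub> w) = g v \<oplus>\<^bsub>G\<^esub> g w"
      using assms(2) by (simp add: complex_linear_def flip: assms(3))
  next
    fix c v assume "v \<in> carrier F"
    then show "g (c \<odot>\<^bsub>F\<^esub> v) = c \<odot>\<^bsub>G\<^esub> g v"
      using assms(2) by (simp add: complex_linear_def flip: assms(3))
  qed
qed

lemma complex_linear_inverse:
  assumes F: "module complex_field F" and f: "complex_linear F G f"
    and g: "g \<in> carrier G \<rightarrow> carrier F"
    and gf: "\<And>v. v \<in> carrier F \<Longrightarrow> g (f v) = v" and fg: "\<And>w. w \<in> carrier G \<Longrightarrow> f (g w) = w"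
  shows "complex_linear G F g"
proof -
  interpret F: module complex_field F
    by fact
  have "g (v \<oplus>\<^bsub>G\<^esub> w) = g v \<oplus>\<^bsub>F\<^esub> g w" if v: "v \<in> carrier G" and w: "w \<in> carrier G" for v w
  proof -
    have gv: "g v \<in> carrier F" "g w \<in> carrier F"
      using g v w by auto
    then have "f (g v \<oplus>\<^bsub>F\<^esub> g w) = v \<oplus>\<^bsub>G\<^esub> w"
      using f fg v w by (simp add: complex_linear_def)
    then show ?thesis
      using gf[of "g v \<oplus>\<^bsub>F\<^esub> g w"] gv by simp
  qed
  moreover have "g (c \<odot>\<^bsub>G\<^esub> v) = c \<odot>\<^bsub>F\<^esub> g v" if v: "v \<in> carrier G" for c v
  proof -
    have gv: "g v \<in> carrier F"
      using g v by auto
    then have "f (c \<odot>\<^bsub>F\<^esub> g v) = c \<odot>\<^bsub>G\<^esub> v"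
      using f fg v by (simp add: complex_linear_def)
    then show ?thesis
      using gf[of "c \<odot>\<^bsub>F\<^esub> g v"] gv by simp
  qed
  ultimately show ?thesis
    using g by (simp add: complex_linear_def)
qed

definition push_module :: "('a \<Rightarrow> 'b) \<Rightarrow> ('r, 'a) module \<Rightarrow> ('r, 'b) module"
  where "push_module i F =
    \<lparr>carrier = i ` carrier F, mult = undefined, one = undefined, zero = i \<zero>\<^bsub>F\<^esub>,
     add = (\<lambda>v w. i (inv_into (carrier F) i v \<oplus>\<^bsub>F\<^esub> inv_into (carrier F) i w)),
     smult = (\<lambda>c v. i (c \<odot>\<^bsub>F\<^esub> inv_into (carrier F) i v))\<rparr>"

lemma push_module_simps:
  assumes "inj_on i (carrier F)"
  shows "carrier (push_module i F) = i ` carrier F"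
    and "\<zero>\<^bsub>push_module i F\<^esub> = i \<zero>\<^bsub>F\<^esub>"
    and "v \<in> carrier F \<Longrightarrow> w \<in> carrier F \<Longrightarrow> i v \<oplus>\<^bsub>push_module i F\<^esub> i w = i (v \<oplus>\<^bsub>F\<^esub> w)"
    and "v \<in> carrier F \<Longrightarrow> c \<odot>\<^bsub>push_module i F\<^esub> i v = i (c \<odot>\<^bsub>F\<^esub> v)"
  using assms by (simp_all add: push_module_def)

lemma module_push_module:
  assumes "module R F" and inj: "inj_on i (carrier F)"
  shows "module R (push_module i F)"
proof -
  interpret F: module R F
    by fact
  note simps = push_module_simps[OF inj]
  show ?thesis
  proof (rule moduleI)
    show "cring R"
      by (rule F.R.is_cring)
    show "abelian_group (push_module i F)"
    proof (rule abelian_groupI)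
      fix x assume "x \<in> carrier (push_module i F)"
      then obtain v where v: "v \<in> carrier F" "x = i v"
        by (auto simp: simps)
      have "i (\<ominus>\<^bsub>F\<^esub> v) \<oplus>\<^bsub>push_module i F\<^esub> x = \<zero>\<^bsub>push_module i F\<^esub>"
        using v by (simp add: simps F.l_neg)
      then show "\<exists>y\<in>carrier (push_module i F). y \<oplus>\<^bsub>push_module i F\<^esub> x = \<zero>\<^bsub>push_module i F\<^esub>"
        using v by (auto simp: simps intro!: bexI[of _ "\<ominus>\<^bsub>F\<^esub> v"])
    qed (auto simp: simps F.a_ac)
  qed (auto simp: simps F.smult_l_distr F.smult_r_distr F.smult_assoc1)
qed

lemma complex_linear_push_module:
  assumes "inj_on i (carrier F)"
  shows "complex_linear F (push_module i F) i"
  using push_module_simps[OF assms] by (auto simp: complex_linear_def)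

section \<open>Restrictions and isomorphisms of line bundles\<close>

lemma total_space_restrict_line_bundle [simp]:
  "total_space (restrict_line_bundle L W) = restrict_manifold (total_space L) (part_over L W)"
  "bproj (restrict_line_bundle L W) = bproj L"
  "fibre (restrict_line_bundle L W) = fibre L"
  by (simp_all add: restrict_line_bundle_def)

lemma part_over_subset: "part_over L W \<subseteq> topspace (points (total_space L))"
  by (auto simp: part_over_def)

lemma part_over_restrict_line_bundle:
  "part_over (restrict_line_bundle L W) W' = part_over L (W \<inter> W')"
  by (auto simp: part_over_def restrict_line_bundle_def)

lemma openin_part_over:
  assumes "continuous_map (points (total_space L)) (top_of_set U) (bproj L)" "open W"
  shows "openin (points (total_space L)) (part_over L W)"
proof -
  \<comment> \<open>\<open>W\<close> may stick out of the base, so the preimage is taken of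
    \<open>U \<inter> W\<close>, which is open in \<open>top_of_set U\<close>.\<close>
  have "openin (points (total_space L))
      {e \<in> topspace (points (total_space L)). bproj L e \<in> U \<inter> W}"
    using assms by (intro openin_continuous_map_preimage[where Y = "top_of_set U"]) auto
  moreover have "{e \<in> topspace (points (total_space L)). bproj L e \<in> U \<inter> W} = part_over L W"
    using assms(1) by (auto simp: part_over_def continuous_map)
  ultimately show ?thesis
    by simp
qed

definition line_bundle_maps ::
    "'b::complex_normed_vector set \<Rightarrow> ('e, 'b) bundle_data \<Rightarrow> ('f, 'b) bundle_data \<Rightarrow>
     ('e \<Rightarrow> 'f) \<Rightarrow> ('f \<Rightarrow> 'e) \<Rightarrow> bool"
  where "line_bundle_maps U L L' f g \<longleftrightarrow>
    biholomorphic_maps (total_space L) (total_space L') f g \<and>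
    (\<forall>e \<in> topspace (points (total_space L)). bproj L' (f e) = bproj L e) \<and>
    (\<forall>x\<in>U. complex_linear (fibre L x) (fibre L' x) f)"

lemma line_bundle_isomorphic_iff:
  "line_bundle_isomorphic U L L' \<longleftrightarrow> (\<exists>f g. line_bundle_maps U L L' f g)"
  unfolding line_bundle_isomorphic_def line_bundle_maps_def biholomorphic_map_iff by blast

lemma line_bundle_maps_sym:
  assumes fg: "line_bundle_maps U L L' f g"
    and F: "\<And>x. x \<in> U \<Longrightarrow> module complex_field (fibre L x)"
    and carr: "\<And>x. x \<in> U \<Longrightarrow> carrier (fibre L x) = part_over L {x}"
    and carr': "\<And>x. x \<in> U \<Longrightarrow> carrier (fibre L' x) = part_over L' {x}"
  shows "line_bundle_maps U L' L g f"
proof -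
  have b: "biholomorphic_maps (total_space L) (total_space L') f g"
    and p: "\<And>e. e \<in> topspace (points (total_space L)) \<Longrightarrow> bproj L' (f e) = bproj L e"
    and lin: "\<And>x. x \<in> U \<Longrightarrow> complex_linear (fibre L x) (fibre L' x) f"
    using fg by (auto simp: line_bundle_maps_def)
  have g: "g e \<in> topspace (points (total_space L))" "f (g e) = e"
    if "e \<in> topspace (points (total_space L'))" for e
    using b that by (auto simp: biholomorphic_maps_def holomorphic_map_in_topspace)
  have gf: "g (f e) = e" if "e \<in> topspace (points (total_space L))" for e
    using b that by (auto simp: biholomorphic_maps_def)
  have p': "bproj L (g e) = bproj L' e" if "e \<in> topspace (points (total_space L'))" for e
    using p[OF g(1)[OF that]] g(2)[OF that] by simp
  have "complex_linear (fibre L' x) (fibre L x) g" if x: "x \<in> U" for x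
    by (rule complex_linear_inverse[OF F[OF x] lin[OF x]])
      (use g p' gf in \<open>auto simp: carr[OF x] carr'[OF x] part_over_def\<close>)
  then show ?thesis
    using biholomorphic_maps_sym[OF b] p' by (simp add: line_bundle_maps_def)
qed

lemma holomorphic_line_bundleD:
  assumes "holomorphic_line_bundle U L"
  shows "complex_manifold (total_space L)"
    and "holomorphic_map (total_space L) (open_manifold U) (bproj L)"
    and "x \<in> U \<Longrightarrow> module complex_field (fibre L x)"
    and "x \<in> U \<Longrightarrow> carrier (fibre L x) = part_over L {x}"
    and "x \<in> U \<Longrightarrow> \<exists>W h. open W \<and> x \<in> W \<and> W \<subseteq> U \<and> local_trivialization L W h"
    and "continuous_map (points (total_space L)) (top_of_set U) (bproj L)"
    and "e \<in> topspace (points (total_space L)) \<Longrightarrow> bproj L e \<in> U"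
proof -
  show *: "continuous_map (points (total_space L)) (top_of_set U) (bproj L)"
    using assms holomorphic_mapD(1)[of "total_space L" "open_manifold U" "bproj L"]
    by (simp add: holomorphic_line_bundle_def open_manifold_def)
  show "e \<in> topspace (points (total_space L)) \<Longrightarrow> bproj L e \<in> U"
    using * by (auto simp: continuous_map)
qed (use assms in \<open>auto simp: holomorphic_line_bundle_def\<close>)

lemma holomorphic_bproj_of_isomorphic:
  fixes U :: "'b::{complex_normed_vector, second_countable_topology} set"
  assumes "complex_manifold (total_space L)" "complex_manifold (total_space L')"
    and iso: "line_bundle_maps U L L' f g"
    and p: "holomorphic_map (total_space L') (open_manifold U) (bproj L')"
  shows "holomorphic_map (total_space L) (open_manifold U) (bproj L)"
proof -
  have "holomorphic_map (total_space L) (open_manifold U) (bproj L' \<circ> f)"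
    using holomorphic_map_compose[OF assms(1,2) _ p] iso
    by (simp add: line_bundle_maps_def biholomorphic_maps_def)
  then show ?thesis
    by (rule holomorphic_map_cong[OF assms(1)]) (use iso in \<open>auto simp: line_bundle_maps_def\<close>)
qed

text \<open>A trivialization is pulled back by composing it with the isomorphism; fibrewise
  linearity and the condition on the first component survive because \<open>f\<close> covers the
  identity.\<close>

lemma local_trivialization_of_isomorphic:
  fixes U :: "'b::{complex_normed_vector, second_countable_topology} set"
  assumes L: "complex_manifold (total_space L)" and L': "complex_manifold (total_space L')"
    and iso: "line_bundle_maps U L L' f g"
    and cont: "continuous_map (points (total_space L')) (top_of_set U) (bproj L')"
    and W: "open W" "W \<subseteq> U" and h: "local_trivialization L' W h"
  shows "local_trivialization L W (h \<circ> f)"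
proof -
  have b: "biholomorphic_maps (total_space L) (total_space L') f g"
    and p: "\<And>e. e \<in> topspace (points (total_space L)) \<Longrightarrow> bproj L' (f e) = bproj L e"
    and lin: "\<And>x. x \<in> U \<Longrightarrow> complex_linear (fibre L x) (fibre L' x) f"
    using iso by (auto simp: line_bundle_maps_def)
  have f: "f e \<in> topspace (points (total_space L'))" if "e \<in> topspace (points (total_space L))" for e
    using b that by (auto simp: biholomorphic_maps_def holomorphic_map_in_topspace)
  have g: "g e \<in> topspace (points (total_space L))" "f (g e) = e"
    if "e \<in> topspace (points (total_space L'))" for e
    using b that by (auto simp: biholomorphic_maps_def holomorphic_map_in_topspace)
  have p': "bproj L (g e) = bproj L' e" if "e \<in> topspace (points (total_space L'))" for e
    using p[OF g(1)[OF that]] g(2)[OF that] by simp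
  have op': "openin (points (total_space L')) (part_over L' W)"
    using openin_part_over[OF cont W(1)] .
  \<comment> \<open>Continuity is assumed for the projection of \<open>L'\<close>, so openness of
    the part of \<open>L\<close> over \<open>W\<close> is obtained as a preimage under
    \<open>f\<close>.\<close>
  have "part_over L W = {e \<in> topspace (points (total_space L)). f e \<in> part_over L' W}"
    using f p by (auto simp: part_over_def)
  then have op: "openin (points (total_space L)) (part_over L W)"
    using openin_continuous_map_preimage[OF holomorphic_mapD(1) op', of "total_space L" f] b
    by (simp add: biholomorphic_maps_def)
  have f': "f ` part_over L W \<subseteq> part_over L' W" and g': "g ` part_over L' W \<subseteq> part_over L W"
    using f p g p' by (auto simp: part_over_def)
  obtain k where k: "biholomorphic_maps (restrict_manifold (total_space L') (part_over L' W))
      (open_manifold (W \<times> UNIV)) h k"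
    using h by (auto simp: local_trivialization_def biholomorphic_map_iff)
  have "biholomorphic_maps (restrict_manifold (total_space L) (part_over L W))
      (open_manifold (W \<times> UNIV)) (h \<circ> f) (g \<circ> k)"
  proof (rule biholomorphic_maps_compose[OF _ _ _ _ k])
    show "biholomorphic_maps (restrict_manifold (total_space L) (part_over L W))
        (restrict_manifold (total_space L') (part_over L' W)) f g"
      using biholomorphic_maps_restrict[OF L L' b op op' f' g'] .
    show "complex_manifold (open_manifold (W \<times> (UNIV :: complex set)))"
      using W(1) by (intro complex_manifold_open_manifold open_Times) auto
  qed (use L L' op op' in \<open>simp_all add: complex_manifold_restrict\<close>)
  moreover have "fst ((h \<circ> f) e) = bproj L e" if "e \<in> part_over L W" for e
  proof -
    have "f e \<in> part_over L' W" "e \<in> topspace (points (total_space L))"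
      using f' that part_over_subset[of L W] by blast+
    then show ?thesis
      using h p by (simp add: local_trivialization_def)
  qed
  moreover have "complex_linear (fibre L x) complex_line (snd \<circ> (h \<circ> f))" if "x \<in> W" for x
    using complex_linear_compose[OF lin, of x complex_line "snd \<circ> h"] h that W(2)
    by (auto simp: local_trivialization_def o_assoc)
  ultimately show ?thesis
    by (auto simp: local_trivialization_def biholomorphic_map_iff)
qed

text \<open>Restricting to \<open>U\<close> and then to the smaller \<open>W\<close> is the same as
  restricting to \<open>W\<close>, so trivializations found on a restriction are trivializations of
  the whole bundle.\<close>

lemma local_trivialization_restrict_line_bundle:
  "W \<subseteq> U \<Longrightarrow> local_trivialization (restrict_line_bundle L U) W h = local_trivialization L W h"
proof -
  assume "W \<subseteq> U"
  then have "part_over L (U \<inter> W) = part_over L W" "part_over L U \<inter> part_over L W = part_over L W"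
    by (auto simp: part_over_def)
  then show ?thesis
    by (simp add: local_trivialization_def part_over_restrict_line_bundle restrict_restrict_manifold)
qed

section \<open>Gluing two line bundles\<close>

text \<open>The base type is any second countable model space; the class makes
  \<open>W \<times> UNIV\<close> a complex manifold in the sense of the definition, which composing
  trivializations requires.\<close>

locale line_bundle_gluing =
  fixes U V :: "'b::{complex_normed_vector, second_countable_topology} set"
    and LU :: "('e, 'b) bundle_data" and LV :: "('f, 'b) bundle_data"
    and f :: "'e \<Rightarrow> 'f" and g :: "'f \<Rightarrow> 'e"
  assumes open_U: "open U" and open_V: "open V"
    and LU: "holomorphic_line_bundle U LU" and LV: "holomorphic_line_bundle V LV"
    and iso: "line_bundle_maps (U \<inter> V)
      (restrict_line_bundle LU (U \<inter> V)) (restrict_line_bundle LV (U \<inter> V)) f g"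
begin

abbreviation "EU \<equiv> topspace (points (total_space LU))"
abbreviation "EV \<equiv> topspace (points (total_space LV))"
abbreviation "PU \<equiv> part_over LU (U \<inter> V)"
abbreviation "PV \<equiv> part_over LV (U \<inter> V)"

abbreviation inl :: "'e \<Rightarrow> 'e + 'f"
  where "inl \<equiv> Inl"

text \<open>The points of the glued bundle are those of \<open>LU\<close> together with the points of \<open>LV\<close> not
  lying over \<open>U\<close>, so no quotient type is needed.\<close>

definition emb :: "'f \<Rightarrow> 'e + 'f"
  where "emb e = (if bproj LV e \<in> U then inl (g e) else Inr e)"

definition proj :: "'e + 'f \<Rightarrow> 'b"
  where "proj = case_sum (bproj LU) (bproj LV)"

abbreviation MU :: "('e + 'f, 'b \<times> complex) manifold_data"
  where "MU \<equiv> push_manifold inl (total_space LU)"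

abbreviation MV :: "('e + 'f, 'b \<times> complex) manifold_data"
  where "MV \<equiv> push_manifold emb (total_space LV)"

text \<open>Over the overlap the vector space structure is taken from \<open>LU\<close>; that
  \<open>LV\<close> induces the same one is the linearity of \<open>g\<close>.\<close>

definition glued :: "('e + 'f, 'b) bundle_data"
  where "glued = \<lparr>total_space = manifold_union MU MV, bproj = proj,
    fibre = (\<lambda>x. if x \<in> U then push_module inl (fibre LU x) else push_module emb (fibre LV x))\<rparr>"

section \<open>The two embeddings and their overlap\<close>

lemmas LU_facts = holomorphic_line_bundleD[OF LU]
lemmas LV_facts = holomorphic_line_bundleD[OF LV]

lemma g_in: "d \<in> PV \<Longrightarrow> g d \<in> PU" and f_g: "d \<in> PV \<Longrightarrow> f (g d) = d"
  and f_in: "e \<in> PU \<Longrightarrow> f e \<in> PV" and g_f: "e \<in> PU \<Longrightarrow> g (f e) = e"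
  and maps_fg: "biholomorphic_maps (restrict_manifold (total_space LU) PU)
    (restrict_manifold (total_space LV) PV) f g"
proof -
  show b: "biholomorphic_maps (restrict_manifold (total_space LU) PU)
      (restrict_manifold (total_space LV) PV) f g"
    using iso by (simp add: line_bundle_maps_def)
  have top: "topspace (points (restrict_manifold (total_space LU) PU)) = PU"
    "topspace (points (restrict_manifold (total_space LV) PV)) = PV"
    by (simp_all add: Int_absorb1 part_over_subset)
  show "g d \<in> PU" "f (g d) = d" if "d \<in> PV"
    using that b holomorphic_map_in_topspace[of "restrict_manifold (total_space LV) PV"
        "restrict_manifold (total_space LU) PU" g d]
    unfolding biholomorphic_maps_def top by simp_all
  show "f e \<in> PV" "g (f e) = e" if "e \<in> PU"
    using that b holomorphic_map_in_topspace[of "restrict_manifold (total_space LU) PU"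
        "restrict_manifold (total_space LV) PV" f e]
    unfolding biholomorphic_maps_def top by simp_all
qed

lemma proj_f: "e \<in> PU \<Longrightarrow> bproj LV (f e) = bproj LU e"
  using iso part_over_subset[of LU] by (auto simp: line_bundle_maps_def)

lemma linear_g:
  assumes "x \<in> U" "x \<in> V"
  shows "complex_linear (fibre LV x) (fibre LU x) g"
proof -
  have "U \<inter> V \<inter> {x} = {x}" if "x \<in> U \<inter> V" for x
    using that by auto
  then have "line_bundle_maps (U \<inter> V) (restrict_line_bundle LV (U \<inter> V))
      (restrict_line_bundle LU (U \<inter> V)) g f"
    by (intro line_bundle_maps_sym[OF iso])
      (simp_all add: part_over_restrict_line_bundle LU_facts(3,4) LV_facts(4))
  then show ?thesis
    using assms by (simp add: line_bundle_maps_def)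
qed

lemma proj_g: "e \<in> PV \<Longrightarrow> bproj LU (g e) = bproj LV e"
  using proj_f[OF g_in] f_g by simp

text \<open>Points of \<open>LV\<close> project into \<open>V\<close> anyway, so the case
  distinction in \<open>emb\<close> is membership in the overlap part.\<close>

lemma PV_iff: "e \<in> EV \<Longrightarrow> e \<in> PV \<longleftrightarrow> bproj LV e \<in> U"
  using LV_facts(7) by (auto simp: part_over_def)

lemma PU_iff: "e \<in> EU \<Longrightarrow> e \<in> PU \<longleftrightarrow> bproj LU e \<in> V"
  using LU_facts(7) by (auto simp: part_over_def)

lemma emb_f: "e \<in> PU \<Longrightarrow> emb (f e) = inl e"
  using PV_iff[of "f e"] f_in[of e] g_f[of e] part_over_subset[of LV] by (auto simp: emb_def)

lemma proj_emb: "e \<in> EV \<Longrightarrow> proj (emb e) = bproj LV e"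
  using PV_iff[of e] proj_g[of e] by (auto simp: emb_def proj_def)

lemma proj_Inl: "proj (inl e) = bproj LU e"
  by (simp add: proj_def)

text \<open>The two branches of \<open>emb\<close> land in different summands, and on the first one
  \<open>g\<close> is injective because \<open>f\<close> inverts it.\<close>

lemma inj_emb: "inj_on emb EV"
proof (rule inj_onI)
  fix d e assume d: "d \<in> EV" and e: "e \<in> EV" and eq: "emb d = emb e"
  show "d = e"
  proof (cases "bproj LV d \<in> U")
    case True
    then have "bproj LV e \<in> U" "g d = g e"
      using eq by (simp_all add: emb_def split: if_splits)
    then show ?thesis
      using True f_g[of d] f_g[of e] PV_iff[OF d] PV_iff[OF e] by metis
  next
    case False
    then show ?thesis
      using eq by (simp add: emb_def split: if_splits)
  qed
qed

lemma inj_Inl: "inj_on inl A"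
  by (simp add: inj_on_def)

lemma topspace_MU: "topspace (points MU) = inl ` EU"
  by (rule topspace_push_manifold) (rule inj_Inl)

lemma topspace_MV: "topspace (points MV) = emb ` EV"
  by (rule topspace_push_manifold) (rule inj_emb)

lemma emb_PV: "emb ` PV = inl ` PU"
proof
  show "emb ` PV \<subseteq> inl ` PU"
  proof
    fix y assume "y \<in> emb ` PV"
    then obtain d where "d \<in> PV" "y = emb d"
      by blast
    then show "y \<in> inl ` PU"
      using PV_iff[of d] g_in[of d] part_over_subset[of LV] by (auto simp: emb_def)
  qed
  show "inl ` PU \<subseteq> emb ` PV"
  proof
    fix y assume "y \<in> inl ` PU"
    then obtain e where "e \<in> PU" "y = inl e"
      by blast
    then show "y \<in> emb ` PV"
      using emb_f[of e] f_in[of e] image_eqI[of y emb "f e" PV] by simp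
  qed
qed

lemma overlap: "inl ` PU = topspace (points MU) \<inter> topspace (points MV)"
proof
  have "inl ` PU \<subseteq> inl ` EU" "emb ` PV \<subseteq> emb ` EV"
    by (rule image_mono[OF part_over_subset])+
  then show "inl ` PU \<subseteq> topspace (points MU) \<inter> topspace (points MV)"
    unfolding topspace_MU topspace_MV emb_PV by blast
  show "topspace (points MU) \<inter> topspace (points MV) \<subseteq> inl ` PU"
  proof
    fix y assume "y \<in> topspace (points MU) \<inter> topspace (points MV)"
    then obtain e d where "y = inl e" and d: "d \<in> EV" "y = emb d"
      unfolding topspace_MU topspace_MV by blast
    \<comment> \<open>A value of \<open>emb\<close> in the left summand can only come from its first
      branch.\<close>
    then have "bproj LV d \<in> U"
      by (simp add: emb_def split: if_splits)
    then have "y \<in> emb ` PV"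
      using d PV_iff by simp
    then show "y \<in> inl ` PU"
      using emb_PV by simp
  qed
qed

section \<open>The glued complex structure\<close>

lemma manifold_MU: "complex_manifold MU"
  by (rule complex_manifold_push[OF LU_facts(1) inj_Inl])

lemma manifold_MV: "complex_manifold MV"
  by (rule complex_manifold_push[OF LV_facts(1) inj_emb])

text \<open>On the overlap the identity factors through \<open>LU\<close> and \<open>LV\<close> as
  \<open>emb \<circ> (f \<circ> ?i)\<close>, a composite of biholomorphic maps; its inverse, again
  the identity there, gives the other direction.\<close>

lemma compatible: "compatible_on_overlap MU MV" "compatible_on_overlap MV MU"
proof -
  let ?S = "inl ` PU" and ?i = "inv_into EU inl" and ?j = "inv_into EV emb"
  have PU: "openin (points (total_space LU)) PU" and PV: "openin (points (total_space LV)) PV"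
    using openin_part_over[OF LU_facts(6) open_Int[OF open_U open_V]]
      openin_part_over[OF LV_facts(6) open_Int[OF open_U open_V]] .
  have SU: "openin (points MU) ?S"
    using openin_push_manifold[OF inj_Inl] PU by blast
  have SV: "openin (points MV) ?S"
    using openin_push_manifold[OF inj_emb] PV emb_PV by metis
  have i: "?i (inl e) = e" if "e \<in> PU" for e
    using that part_over_subset[of LU] by (intro inv_into_f_f inj_Inl) blast
  have j: "?j (emb e) = e" if "e \<in> PV" for e
    using that part_over_subset[of LV] by (intro inv_into_f_f inj_emb) blast
  have bU: "biholomorphic_maps (restrict_manifold MU ?S) (restrict_manifold (total_space LU) PU) ?i inl"
    by (rule biholomorphic_maps_restrict[OF manifold_MU LU_facts(1)
          biholomorphic_maps_sym[OF biholomorphic_maps_push[OF LU_facts(1) inj_Inl]] SU PU])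
      (auto simp: i)
  have bV: "biholomorphic_maps (restrict_manifold (total_space LV) PV) (restrict_manifold MV ?S) emb ?j"
    by (rule biholomorphic_maps_restrict[OF LV_facts(1) manifold_MV
          biholomorphic_maps_push[OF LV_facts(1) inj_emb] PV SV])
      (simp_all add: emb_PV[symmetric] image_image j)
  note mU = complex_manifold_restrict[OF LU_facts(1) PU]
    and mV = complex_manifold_restrict[OF LV_facts(1) PV]
    and mMU = complex_manifold_restrict[OF manifold_MU SU]
    and mMV = complex_manifold_restrict[OF manifold_MV SV]
  have b: "biholomorphic_maps (restrict_manifold MU ?S) (restrict_manifold MV ?S)
      (emb \<circ> (f \<circ> ?i)) ((inl \<circ> g) \<circ> ?j)"
    using biholomorphic_maps_compose[OF mMU mV mMV biholomorphic_maps_compose[OF mMU mU mV bU maps_fg] bV] .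
  have id1: "(emb \<circ> (f \<circ> ?i)) x = x" if x: "x \<in> ?S" for x
  proof -
    obtain e where e: "e \<in> PU" "x = inl e"
      using x by blast
    show ?thesis
      unfolding e(2) comp_def i[OF e(1)] by (rule emb_f[OF e(1)])
  qed
  have id2: "((inl \<circ> g) \<circ> ?j) x = x" if x: "x \<in> ?S" for x
  proof -
    obtain d where d: "d \<in> PV" "x = emb d"
      using x emb_PV by blast
    then have emb_d: "emb d = inl (g d)"
      using PV_iff[OF subsetD[OF part_over_subset d(1)]] by (simp add: emb_def)
    show ?thesis
      unfolding d(2) comp_def j[OF d(1)] using emb_d by simp
  qed
  have hol: "holomorphic_map (restrict_manifold MU ?S) (restrict_manifold MV ?S) (emb \<circ> (f \<circ> ?i))"
    "holomorphic_map (restrict_manifold MV ?S) (restrict_manifold MU ?S) ((inl \<circ> g) \<circ> ?j)"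
    using biholomorphic_mapsD[OF b] .
  show "compatible_on_overlap MU MV"
    by (rule compatible_on_overlapI[OF manifold_MU manifold_MV SU SV overlap hol(1) id1])
  show "compatible_on_overlap MV MU"
    by (rule compatible_on_overlapI[OF manifold_MV manifold_MU SV SU
          overlap[THEN trans, OF Int_commute] hol(2) id2])
qed

text \<open>Everything over \<open>U\<close> lies in the left piece, since \<open>emb\<close> sends
  points over \<open>U\<close> to the left summand. Together with its counterpart for
  \<open>V\<close> this identifies the pieces with the parts over \<open>U\<close> and
  \<open>V\<close>.\<close>

lemma sub_U:
  assumes "x \<in> topspace (points MU) \<union> topspace (points MV)" "proj x \<in> U"
  shows "x \<in> topspace (points MU)"
proof (cases "x \<in> topspace (points MU)")
  case False
  then obtain d where d: "d \<in> EV" "x = emb d"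
    using assms(1) unfolding topspace_MV by blast
  then have "d \<in> PV"
    using assms(2) proj_emb PV_iff by simp
  then have "x \<in> inl ` PU"
    using d emb_PV by blast
  then show ?thesis
    using overlap by blast
qed simp

lemma sub_V:
  assumes "x \<in> topspace (points MU) \<union> topspace (points MV)" "proj x \<in> V"
  shows "x \<in> topspace (points MV)"
proof (cases "x \<in> topspace (points MV)")
  case False
  then obtain e where e: "e \<in> EU" "x = inl e"
    using assms(1) unfolding topspace_MU by blast
  then have "x \<in> inl ` PU"
    using assms(2) proj_Inl PU_iff by simp
  then show ?thesis
    using overlap by blast
qed simp

lemma proj_in_U:
  assumes "x \<in> topspace (points MU)"
  shows "proj x \<in> U"
proof -
  obtain e where "e \<in> EU" "x = inl e"
    using assms unfolding topspace_MU by blast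
  then show ?thesis
    using LU_facts(7)[of e] by (simp add: proj_Inl)
qed

lemma proj_in_V:
  assumes "x \<in> topspace (points MV)"
  shows "proj x \<in> V"
proof -
  obtain d where "d \<in> EV" "x = emb d"
    using assms unfolding topspace_MV by blast
  then show ?thesis
    using LV_facts(7)[of d] by (simp add: proj_emb)
qed

lemma manifold_glued: "complex_manifold (manifold_union MU MV)"
proof (rule complex_manifold_union[OF manifold_MU manifold_MV compatible])
  \<comment> \<open>The two pieces project to different open sets, so the whole model space serves
    as common codomain.\<close>
  have 1: "continuous_map (points MU) euclidean proj"
  proof -
    have "continuous_map (points MU) (points (total_space LU)) (inv_into EU inl)"
      using holomorphic_mapD(1)[OF biholomorphic_mapsD(2)[OF biholomorphic_maps_push[OF LU_facts(1) inj_Inl]]] .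
    then have c: "continuous_map (points MU) euclidean (bproj LU \<circ> inv_into EU inl)"
      by (rule continuous_map_compose[OF _ continuous_map_into_fulltopology[OF LU_facts(6)]])
    have "(bproj LU \<circ> inv_into EU inl) x = proj x" if x: "x \<in> topspace (points MU)" for x
    proof -
      obtain e where "e \<in> EU" "x = inl e"
        using x unfolding topspace_MU by blast
      then show ?thesis
        by (simp add: proj_Inl inv_into_f_f[OF inj_Inl])
    qed
    then show ?thesis
      by (rule continuous_map_eq[OF c])
  qed
  have 2: "continuous_map (points MV) euclidean proj"
  proof -
    have "continuous_map (points MV) (points (total_space LV)) (inv_into EV emb)"
      using holomorphic_mapD(1)[OF biholomorphic_mapsD(2)[OF biholomorphic_maps_push[OF LV_facts(1) inj_emb]]] .
    then have c: "continuous_map (points MV) euclidean (bproj LV \<circ> inv_into EV emb)"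
      by (rule continuous_map_compose[OF _ continuous_map_into_fulltopology[OF LV_facts(6)]])
    have "(bproj LV \<circ> inv_into EV emb) x = proj x" if x: "x \<in> topspace (points MV)" for x
    proof -
      obtain d where "d \<in> EV" "x = emb d"
        using x unfolding topspace_MV by blast
      then show ?thesis
        by (simp add: proj_emb inv_into_f_f[OF inj_emb])
    qed
    then show ?thesis
      by (rule continuous_map_eq[OF c])
  qed
  show "Hausdorff_space (points (manifold_union MU MV))"
  proof (rule Hausdorff_space_manifold_union[OF manifold_MU manifold_MV compatible 1 2])
    \<comment> \<open>Since \<open>y\<close> lies over \<open>V\<close>, so does \<open>x\<close>,
      and every point over \<open>V\<close> belongs to the right piece.\<close>
    show "x \<in> topspace (points MV) \<or> y \<in> topspace (points MU)"
      if "x \<in> topspace (points MU)" "y \<in> topspace (points MV)" "proj x = proj y" for x y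
    proof -
      have "proj x \<in> V"
        using proj_in_V[OF that(2)] that(3) by simp
      then show ?thesis
        using sub_V[OF UnI1[OF that(1)]] by simp
    qed
  qed (rule Hausdorff_space_euclidean)
qed

section \<open>Fibres of the glued bundle\<close>

lemma part_over_glued:
  "part_over glued U = topspace (points MU)" "part_over glued V = topspace (points MV)"
proof -
  have *: "part_over glued W = {x \<in> topspace (points MU) \<union> topspace (points MV). proj x \<in> W}" for W
    by (simp add: part_over_def glued_def topspace_manifold_union)
  show "part_over glued U = topspace (points MU)"
    using sub_U proj_in_U unfolding * by blast
  show "part_over glued V = topspace (points MV)"
    using sub_V proj_in_V unfolding * by blast
qed

lemma fibre_inj: "x \<in> V \<Longrightarrow> inj_on emb (carrier (fibre LV x))"
  using LV_facts(4) part_over_subset[of LV] inj_emb by (metis inj_on_subset)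

lemma fibre_glued_U:
  assumes x: "x \<in> U"
  shows "module complex_field (fibre glued x)" "carrier (fibre glued x) = part_over glued {x}"
proof -
  show "module complex_field (fibre glued x)"
    using x module_push_module[OF LU_facts(3)[OF x] inj_Inl] by (simp add: glued_def)
  have "part_over glued {x} = {y \<in> part_over glued U. proj y = x}"
    using x by (auto simp: part_over_def glued_def)
  also have "\<dots> = inl ` part_over LU {x}"
    unfolding part_over_glued topspace_MU by (auto simp: part_over_def proj_Inl)
  finally show "carrier (fibre glued x) = part_over glued {x}"
    using x by (simp add: glued_def push_module_simps(1)[OF inj_Inl] LU_facts(4))
qed

lemma fibre_glued_V:
  assumes x: "x \<in> V" "x \<notin> U"
  shows "module complex_field (fibre glued x)" "carrier (fibre glued x) = part_over glued {x}"
proof -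
  show "module complex_field (fibre glued x)"
    using x module_push_module[OF LV_facts(3)[OF x(1)] fibre_inj[OF x(1)]] by (simp add: glued_def)
  have "part_over glued {x} = {y \<in> part_over glued V. proj y = x}"
    using x by (auto simp: part_over_def glued_def)
  also have "\<dots> = emb ` part_over LV {x}"
    unfolding part_over_glued topspace_MV by (auto simp: part_over_def proj_emb)
  finally show "carrier (fibre glued x) = part_over glued {x}"
    using x by (simp add: glued_def push_module_simps(1)[OF fibre_inj] LV_facts(4))
qed

lemma fibre_glued:
  assumes "x \<in> U \<union> V"
  shows "module complex_field (fibre glued x)" "carrier (fibre glued x) = part_over glued {x}"
  using assms fibre_glued_U fibre_glued_V by blast+

section \<open>Isomorphisms of the restrictions with the given bundles\<close>

text \<open>Transport along \<open>inl\<close> is followed by the identity from \<open>MU\<close> to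
  its open copy in the union, which has extra charts coming from \<open>LV\<close>.\<close>

lemma maps_U: "line_bundle_maps U LU (restrict_line_bundle glued U) inl (inv_into EU inl)"
proof -
  have b: "biholomorphic_maps MU (restrict_manifold (manifold_union MU MV) (topspace (points MU)))
      (\<lambda>x. x) (\<lambda>x. x)"
    using biholomorphic_maps_union_left[OF manifold_MU manifold_glued compatible(2)]
    by (rule biholomorphic_maps_sym)
  have "openin (points (manifold_union MU MV)) (topspace (points MU))"
    using openin_manifold_union_left[OF compatible(2)] by simp
  then have "biholomorphic_maps (total_space LU)
      (restrict_manifold (manifold_union MU MV) (topspace (points MU))) inl (inv_into EU inl)"
    using biholomorphic_maps_compose[OF LU_facts(1) manifold_MU _
        biholomorphic_maps_push[OF LU_facts(1) inj_Inl] b] manifold_glued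
    by (simp add: complex_manifold_restrict comp_def)
  moreover have "total_space (restrict_line_bundle glued U) =
      restrict_manifold (manifold_union MU MV) (topspace (points MU))"
    using part_over_glued(1) by (simp add: glued_def)
  moreover have "complex_linear (fibre LU x) (fibre glued x) inl" if "x \<in> U" for x
    using complex_linear_push_module[OF inj_Inl, of "fibre LU x"] that by (simp add: glued_def)
  moreover have "bproj glued (inl e) = bproj LU e" for e
    by (simp add: glued_def proj_Inl)
  ultimately show ?thesis
    by (simp add: line_bundle_maps_def)
qed

text \<open>Here the linearity of the given isomorphism enters: over the overlap \<open>emb\<close>
  is \<open>inl \<circ> g\<close> on the fibre, and the target structure is that of
  \<open>LU\<close>.\<close>

lemma linear_emb:
  assumes x: "x \<in> V"
  shows "complex_linear (fibre LV x) (fibre glued x) emb"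
proof (cases "x \<in> U")
  case True
  have "complex_linear (fibre LV x) (fibre glued x) (inl \<circ> g)"
    using complex_linear_compose[OF linear_g[OF True x] complex_linear_push_module[OF inj_Inl]] True
    by (simp add: glued_def)
  then show ?thesis
    by (rule complex_linear_cong[OF LV_facts(3)[OF x]])
      (use x True in \<open>auto simp: LV_facts(4) part_over_def emb_def\<close>)
next
  case False
  then show ?thesis
    using complex_linear_push_module[OF fibre_inj[OF x]] by (simp add: glued_def)
qed

lemma maps_V: "line_bundle_maps V LV (restrict_line_bundle glued V) emb (inv_into EV emb)"
proof -
  have b: "biholomorphic_maps MV (restrict_manifold (manifold_union MU MV) (topspace (points MV)))
      (\<lambda>x. x) (\<lambda>x. x)"
    using biholomorphic_maps_union_left[OF manifold_MV _ compatible(1)] manifold_glued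
    by (simp add: manifold_union_commute[of MU MV] biholomorphic_maps_sym)
  have "openin (points (manifold_union MU MV)) (topspace (points MV))"
    using openin_manifold_union_left[OF compatible(1)] by (simp add: manifold_union_commute[of MU MV])
  then have "biholomorphic_maps (total_space LV)
      (restrict_manifold (manifold_union MU MV) (topspace (points MV))) emb (inv_into EV emb)"
    using biholomorphic_maps_compose[OF LV_facts(1) manifold_MV _
        biholomorphic_maps_push[OF LV_facts(1) inj_emb] b] manifold_glued
    by (simp add: complex_manifold_restrict comp_def)
  moreover have "total_space (restrict_line_bundle glued V) =
      restrict_manifold (manifold_union MU MV) (topspace (points MV))"
    using part_over_glued(2) by (simp add: glued_def)
  moreover have "bproj glued (emb e) = bproj LV e" if "e \<in> EV" for e
    using that by (simp add: glued_def proj_emb)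
  ultimately show ?thesis
    using linear_emb by (simp add: line_bundle_maps_def)
qed

lemma maps_glued_U: "line_bundle_maps U (restrict_line_bundle glued U) LU (inv_into EU inl) inl"
  by (rule line_bundle_maps_sym[OF maps_U])
    (simp_all add: LU_facts(3,4) fibre_glued(2) part_over_restrict_line_bundle Int_absorb1)

lemma maps_glued_V: "line_bundle_maps V (restrict_line_bundle glued V) LV (inv_into EV emb) emb"
  by (rule line_bundle_maps_sym[OF maps_V])
    (simp_all add: LV_facts(3,4) fibre_glued(2) part_over_restrict_line_bundle Int_absorb1)

section \<open>The line bundle axioms for the glued bundle\<close>

lemma open_parts:
  "openin (points (total_space glued)) (part_over glued U)"
  "openin (points (total_space glued)) (part_over glued V)"
  unfolding part_over_glued
  using openin_manifold_union_left[OF compatible(2), of "topspace (points MU)"]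
    openin_manifold_union_left[OF compatible(1), of "topspace (points MV)"]
  by (simp_all add: glued_def manifold_union_commute[of MV MU])

text \<open>Stated for a general \<open>W\<close> so that one argument serves \<open>U\<close> and
  \<open>V\<close>: a trivialization of \<open>L\<close> is pulled back to the restriction, and
  there it already is one of \<open>glued\<close>.\<close>

lemma local_trivialization_glued:
  assumes "line_bundle_maps W (restrict_line_bundle glued W) L f' g'"
    and L: "holomorphic_line_bundle W L"
    and op: "openin (points (total_space glued)) (part_over glued W)" and x: "x \<in> W"
  shows "\<exists>W' h. open W' \<and> x \<in> W' \<and> W' \<subseteq> W \<and> local_trivialization glued W' h"
proof -
  have M: "complex_manifold (total_space (restrict_line_bundle glued W))"
    using op manifold_glued by (simp add: complex_manifold_restrict glued_def)
  obtain W' h where W': "open W'" "x \<in> W'" "W' \<subseteq> W" "local_trivialization L W' h"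
    using holomorphic_line_bundleD(5)[OF L x] by blast
  have "local_trivialization (restrict_line_bundle glued W) W' (h \<circ> f')"
    using local_trivialization_of_isomorphic[OF M holomorphic_line_bundleD(1)[OF L] assms(1)
        holomorphic_line_bundleD(6)[OF L] W'(1,3,4)] .
  then have "local_trivialization glued W' (h \<circ> f')"
    by (simp add: local_trivialization_restrict_line_bundle[OF W'(3)])
  then show ?thesis
    using W'(1-3) by blast
qed

text \<open>The isomorphism gives a holomorphic projection to \<open>W\<close>; viewing
  \<open>open_manifold W\<close> as a restriction of \<open>open_manifold (U \<union> V)\<close>
  enlarges the target.\<close>

lemma holomorphic_bproj_glued:
  assumes "line_bundle_maps W (restrict_line_bundle glued W) L f' g'"
    and L: "holomorphic_line_bundle W L" and W: "W \<subseteq> U \<union> V"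
    and op: "openin (points (total_space glued)) (part_over glued W)"
  shows "holomorphic_map (restrict_manifold (total_space glued) (part_over glued W))
    (open_manifold (U \<union> V)) (bproj glued)"
proof -
  have M: "complex_manifold (total_space (restrict_line_bundle glued W))"
    using op manifold_glued by (simp add: complex_manifold_restrict glued_def)
  have "holomorphic_map (total_space (restrict_line_bundle glued W))
      (restrict_manifold (open_manifold (U \<union> V)) W) (bproj (restrict_line_bundle glued W))"
    unfolding open_manifold_subset[OF W, symmetric]
    using holomorphic_bproj_of_isomorphic[OF M holomorphic_line_bundleD(1)[OF L] assms(1)
        holomorphic_line_bundleD(2)[OF L]] .
  then show ?thesis
    using holomorphic_map_into_restrict[OF M] by simp
qed

lemma holomorphic_line_bundle_glued: "holomorphic_line_bundle (U \<union> V) glued"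
  unfolding holomorphic_line_bundle_def
proof (intro conjI ballI)
  show M: "complex_manifold (total_space glued)"
    using manifold_glued by (simp add: glued_def)
  show "holomorphic_map (total_space glued) (open_manifold (U \<union> V)) (bproj glued)"
  proof (rule holomorphic_map_local[OF M])
    fix e assume "e \<in> topspace (points (total_space glued))"
    then have "e \<in> part_over glued U \<or> e \<in> part_over glued V"
      by (simp add: part_over_glued) (simp add: glued_def topspace_manifold_union)
    then show "\<exists>S. openin (points (total_space glued)) S \<and> e \<in> S \<and>
        holomorphic_map (restrict_manifold (total_space glued) S) (open_manifold (U \<union> V)) (bproj glued)"
    proof
      assume "e \<in> part_over glued U"
      then show ?thesis
        using open_parts(1) holomorphic_bproj_glued[OF maps_glued_U LU Un_upper1 open_parts(1)]
        by blast
    next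
      assume "e \<in> part_over glued V"
      then show ?thesis
        using open_parts(2) holomorphic_bproj_glued[OF maps_glued_V LV Un_upper2 open_parts(2)]
        by blast
    qed
  qed
  fix x assume x: "x \<in> U \<union> V"
  show "module complex_field (fibre glued x)" "carrier (fibre glued x) = part_over glued {x}"
    using fibre_glued[OF x] .
  show "\<exists>W h. open W \<and> x \<in> W \<and> W \<subseteq> U \<union> V \<and> local_trivialization glued W h"
    using x
  proof
    assume "x \<in> U"
    then show ?thesis
      using local_trivialization_glued[OF maps_glued_U LU open_parts(1)] by (meson le_supI1)
  next
    assume "x \<in> V"
    then show ?thesis
      using local_trivialization_glued[OF maps_glued_V LV open_parts(2)] by (meson le_supI2)
  qed
qed

end

theorem lemma1p7:
  fixes U V :: "(complex ^ 'n) set"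
    and LU :: "('e, complex ^ 'n) bundle_data"
    and LV :: "('f, complex ^ 'n) bundle_data"
  assumes "open U" and "open V"
    and "holomorphic_line_bundle U LU" and "holomorphic_line_bundle V LV"
    and "line_bundle_isomorphic (U \<inter> V)
      (restrict_line_bundle LU (U \<inter> V)) (restrict_line_bundle LV (U \<inter> V))"
  shows "\<exists>L :: ('e + 'f, complex ^ 'n) bundle_data.
    holomorphic_line_bundle (U \<union> V) L \<and>
    line_bundle_isomorphic U (restrict_line_bundle L U) LU \<and>
    line_bundle_isomorphic V (restrict_line_bundle L V) LV"
proof -
  \<comment> \<open>The inverse \<open>g\<close> is fixed along with \<open>f\<close> because
    \<open>emb\<close> is built from it.\<close>
  obtain f g where "line_bundle_maps (U \<inter> V)
      (restrict_line_bundle LU (U \<inter> V)) (restrict_line_bundle LV (U \<inter> V)) f g"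
    using assms(5) by (auto simp: line_bundle_isomorphic_iff)
  then interpret line_bundle_gluing U V LU LV f g
    using assms by unfold_locales
  show ?thesis
    using holomorphic_line_bundle_glued maps_glued_U maps_glued_V
    unfolding line_bundle_isomorphic_iff by blast
qed

end
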